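(* Let $\mathcal{H}$ be a real Hilbert space, $A:\mathcal{H}\rightrightarrows\mathcal{H}$ a maximally monotone operator, $D:\mathcal{H}\to\mathcal{H}$ a monotone and $\nu$-Lipschitz continuous operator with $\nu>0$. Let $m\ge1$ be an integer and for each $i\in\{1,\dots,m\}$ let $\mathcal{G}_i$ be a real Hilbert space, $B_i:\mathcal{G}_i\rightrightarrows\mathcal{G}_i$ a maximally monotone operator and $L_i:\mathcal{H}\to\mathcal{G}_i$ a nonzero linear continuous operator. Let $B:\mathcal{H}\to\mathcal{H}$ be monotone and $\mu^{-1}$-Lipschitz continuous with $\mu>0$, and suppose $C:=\operatorname{zer}B\neq\emptyset$. Let $(\lambda_n)_{n\ge0}$, $(\beta_n)_{n\ge0}$ be sequences of positive real numbers. Let $(x_0,v_{1,0},\dots,v_{m,0})\in\mathcal{H}\times\mathcal{G}_1\times\dots\times\mathcal{G}_m$, $y_{-1}=x_0$, $q_{i,-1}=v_{i,0}$ for $i=1,\dots,m$, and for every $n\ge0$ set $$y_n=J_{\lambda_nA}\Big[x_n-\lambda_n\Big(D(y_{n-1})+\sum_{i=1}^mL_i^*q_{i,n-1}\Big)-\lambda_n\beta_nB(y_{n-1})\Big],$$ $$q_{i,n}=J_{\lambda_nB_i^{-1}}\big[v_{i,n}+\lambda_nL_iy_{n-1}\big],\quad i=1,\dots,m,$$ $$x_{n+1}=\lambda_n\beta_n[B(y_{n-1})-B(y_n)]+\lambda_n[D(y_{n-1})-D(y_n)]+\lambda_n\sum_{i=1}^mL_i^*(q_{i,n-1}-q_{i,n})+y_n,$$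 $$v_{i,n+1}=\lambda_nL_i(y_n-y_{n-1})+q_{i,n},\quad i=1,\dots,m.$$ Let $z_n=\frac1{\tau_n}\sum_{k=0}^n\lambda_kx_k$ with $\tau_n=\sum_{k=0}^n\lambda_k$. Assume that: (i) $A+N_C$ is maximally monotone and $\operatorname{zer}\big(A+\sum_{i=1}^mL_i^*B_iL_i+D+N_C\big)\neq\emptyset$; (ii) for every $p\in\operatorname{ran}(N_C)$, $\sum_{n\ge0}\lambda_n\beta_n\Big[\sup_{u\in C}\varphi_B\big(u,\tfrac p{\beta_n}\big)-\sigma_C\big(\tfrac p{\beta_n}\big)\Big]<+\infty$; (iii) $(\lambda_n)_{n\ge0}\in\ell^2\setminus\ell^1$; and that $\limsup_{n\to+\infty}\Big(\frac{\lambda_n\beta_n}\mu+\lambda_n\beta\Big)<\frac12$, where $\beta=\nu+\sqrt{\sum_{i=1}^m\|L_i\|^2}$. Then $(z_n)_{n\ge0}$ converges weakly to an element of $\operatorname{zer}\big(A+\sum_{i=1}^mL_i^*B_iL_i+D+N_C\big)$ as $n\to\infty$. If, additionally, $A$ and $B_i^{-1}$, $i=1,\dots,m$, are strongly monotone, then $(x_n)_{n\ge0}$ converges strongly to the unique element of $\operatorname{zer}\big(A+\sum_{i=1}^mL_i^*B_iL_i+D+N_C\big)$ as $n\to\infty$.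
   Context: For a set-valued operator $T$: $\operatorname{Gr}T=\{(x,u):u\in Tx\}$, $\operatorname{zer}T=\{x:0\in Tx\}$, $\operatorname{ran}T=\{u:\exists x,\ u\in Tx\}$, and $T^{-1}$ is the set-valued inverse. $T$ is strongly monotone if for some $\gamma>0$, $\langle x-y,u-v\rangle\ge\gamma\|x-y\|^2$ for all $(x,u),(y,v)\in\operatorname{Gr}T$. The resolvent is $J_T=(\mathrm{Id}+T)^{-1}$, single-valued and everywhere defined when $T$ is maximally monotone. $L_i^*$ is the adjoint of $L_i$. $N_C$ is the normal cone of the closed convex set $C$: $N_C(x)=\{u:\langle y-x,u\rangle\le0\ \forall y\in C\}$ if $x\in C$, and $\emptyset$ otherwise. $\sigma_C(u)=\sup_{y\in C}\langle y,u\rangle$ is the support function. The Fitzpatrick function of a monotone operator $B$ is $\varphi_B(x,u)=\sup_{(y,v)\in\operatorname{Gr}B}\{\langle x,v\rangle+\langle y,u\rangle-\langle y,v\rangle\}\in\mathbb{R}\cup\{\pm\infty\}$. *)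

theory Defs
  imports "HOL-Analysis.Analysis"
begin

text \<open>
  A set-valued operator is a function \<open>'a \<Rightarrow> 'a set\<close>; a single-valued operator \<open>D\<close> is identified
  with \<open>\<lambda>x. {D x}\<close>. Pointwise sums use the Minkowski sum of sets from \<open>Set_Algebras\<close>, so that
  \<open>A x + {} = {}\<close>.
\<close>

definition Gr :: "('a \<Rightarrow> 'b set) \<Rightarrow> ('a \<times> 'b) set" where
  "Gr T = {(x, u). u \<in> T x}"

definition zer :: "('a \<Rightarrow> 'b::zero set) \<Rightarrow> 'a set" where
  "zer T = {x. 0 \<in> T x}"

definition ran_op :: "('a \<Rightarrow> 'b set) \<Rightarrow> 'b set" where
  "ran_op T = {u. \<exists>x. u \<in> T x}"

definition inv_op :: "('a \<Rightarrow> 'b set) \<Rightarrow> 'b \<Rightarrow> 'a set" where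
  "inv_op T u = {x. u \<in> T x}"

definition scale_op :: "real \<Rightarrow> ('a \<Rightarrow> 'b::real_vector set) \<Rightarrow> 'a \<Rightarrow> 'b set" where
  "scale_op c T x = (\<lambda>u. c *\<^sub>R u) ` T x"

definition monotone_op :: "('a::real_inner \<Rightarrow> 'a set) \<Rightarrow> bool" where
  "monotone_op T \<longleftrightarrow> (\<forall>(x, u) \<in> Gr T. \<forall>(y, v) \<in> Gr T. (x - y) \<bullet> (u - v) \<ge> 0)"

definition strongly_monotone_op :: "('a::real_inner \<Rightarrow> 'a set) \<Rightarrow> bool" where
  "strongly_monotone_op T \<longleftrightarrow>
     (\<exists>\<gamma>>0. \<forall>(x, u) \<in> Gr T. \<forall>(y, v) \<in> Gr T. (x - y) \<bullet> (u - v) \<ge> \<gamma> * (norm (x - y))\<^sup>2)"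

text \<open>
  An operator on a Hilbert space \<open>G\<close> that is carried by a subspace of a type is an operator on the
  whole type whose graph lies in \<open>G \<times> G\<close>; maximality is then maximality among the monotone
  operators on \<open>G\<close>, not on the ambient type.
\<close>

definition maximally_monotone_on :: "'a::real_inner set \<Rightarrow> ('a \<Rightarrow> 'a set) \<Rightarrow> bool" where
  "maximally_monotone_on G T \<longleftrightarrow>
     Gr T \<subseteq> G \<times> G \<and> monotone_op T \<and>
     (\<forall>T'. monotone_op T' \<and> Gr T' \<subseteq> G \<times> G \<and> Gr T \<subseteq> Gr T' \<longrightarrow> Gr T' = Gr T)"

abbreviation maximally_monotone :: "('a::real_inner \<Rightarrow> 'a set) \<Rightarrow> bool" where
  "maximally_monotone T \<equiv> maximally_monotone_on UNIV T"

text \<open>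
  The resolvent \<open>(Id + T)\<^sup>-\<^sup>1\<close> as a function. It is meaningful where the inverse is a singleton:
  everywhere if \<open>T\<close> is maximally monotone, and on \<open>G\<close> if \<open>T\<close> is maximally monotone on a complete
  subspace \<open>G\<close> (the identity of the ambient type may be used there because \<open>T y\<close> is empty for
  \<open>y \<notin> G\<close>).
\<close>

definition resolvent :: "('a::real_inner \<Rightarrow> 'a set) \<Rightarrow> 'a \<Rightarrow> 'a" where
  "resolvent T x = (THE y. y \<in> inv_op (\<lambda>w. {w} + T w) x)"

definition normal_cone :: "'a::real_inner set \<Rightarrow> 'a \<Rightarrow> 'a set" where
  "normal_cone C x = (if x \<in> C then {u. \<forall>y\<in>C. (y - x) \<bullet> u \<le> 0} else {})"

definition support_fun :: "'a::real_inner set \<Rightarrow> 'a \<Rightarrow> ereal" where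
  "support_fun C u = (SUP y\<in>C. ereal (y \<bullet> u))"

definition fitzpatrick :: "('a::real_inner \<Rightarrow> 'a set) \<Rightarrow> 'a \<Rightarrow> 'a \<Rightarrow> ereal" where
  "fitzpatrick T x u = (SUP (y, v)\<in>Gr T. ereal (x \<bullet> v + y \<bullet> u - y \<bullet> v))"

definition weakly_tendsto :: "(nat \<Rightarrow> 'a::real_inner) \<Rightarrow> 'a \<Rightarrow> bool" where
  "weakly_tendsto s l \<longleftrightarrow> (\<forall>w. (\<lambda>n. s n \<bullet> w) \<longlonglongrightarrow> l \<bullet> w)"

end

(* In the product space H x G_1 x ... x G_m the iteration is Tseng's forward-backward-forward
   scheme with a reused forward step, applied to the maximally monotone operator
   (x, b) |-> (A x + N_C x, B_i^-1 b_i) and the monotone Lipschitz map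
   Q (x, b) = (D x + sum L_i^* b_i, - L_i x). For (u, w) in the graph of their sum,
   |X_n - u|^2 + |X_n - Y_(n-1)|^2 decreases up to 2 lambda_n <w, u - Y_n> and the summable
   Fitzpatrick gap, with a surplus of order |Y_n - Y_(n-1)|^2 because the step constant stays
   below 1/2. With w = 0 this is quasi-Fejer monotonicity with vanishing gaps; with general w it
   shows that every weak cluster point l of the averages satisfies <w, u - l> >= 0 on the whole
   graph, hence is a zero. Opial's argument in Passty's ergodic form makes the cluster point unique.
   Strong monotonicity adds the term lambda_n |Y_n - u|^2 to the surplus, and since the lambda_n are
   not summable the limit of |X_n - u| is 0.

   Minty's theorem, the Riesz representation and weak cluster points, which are needed on the way,
   all come from minimizing a strongly convex function and from Tychonoff's theorem. *)
theory Submission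
  imports Defs
begin

section \<open>Minimization without weak compactness\<close>

text \<open>The iteration never evaluates N_C: it produces elements of A + \<beta>_n B, while the
  target contains A + N_C. Comparison with a graph point over u therefore leaves a mismatch between
  \<beta>_n B(y_n) and a normal p at u, and hypothesis (ii) supplies a summable upper bound for it.
  Moreover the forward terms are evaluated at Y_(n-1), not at X_n. The inequality |Y_n - Y_(n-1)|^2
  <= 2|Y_n - X_n|^2 + 2|X_n - Y_(n-1)|^2 yields a gain of 1/2 |Y_n - Y_(n-1)|^2 and is the reason
  for the extra term in the decreasing quantity; the correction with step constant c costs 2 c^2
  |Y_n - Y_(n-1)|^2, whence the threshold c < 1/2. Passing to the inverses B_i^-1 moves the
  compositions with L_i into the skew part of Q, so maximality of the sum needs no condition on
  domains. The product of the G_i is a complete subspace of a type that is in general incomplete;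
  hence Minty, Riesz and weak cluster points are stated relative to a complete subspace.\<close>

lemma nonneg_slope_of_nonneg_quadratic:
  fixes a b :: real
  assumes "\<And>t. 0 < t \<Longrightarrow> t \<le> 1 \<Longrightarrow> 0 \<le> t * a + t\<^sup>2 * b"
  shows "0 \<le> a"
proof (rule field_le_epsilon)
  fix e :: real
  assume "e > 0"
  define t where "t = min 1 (e / (\<bar>b\<bar> + 1))"
  have t: "0 < t" "t \<le> 1" "t * (\<bar>b\<bar> + 1) \<le> e"
  proof -
    show "0 < t" "t \<le> 1"
      using \<open>e > 0\<close> by (auto simp: t_def)
    have "t * (\<bar>b\<bar> + 1) \<le> e / (\<bar>b\<bar> + 1) * (\<bar>b\<bar> + 1)"
      by (intro mult_right_mono) (auto simp: t_def)
    then show "t * (\<bar>b\<bar> + 1) \<le> e"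
      by simp
  qed
  have "0 \<le> t * (a + t * b)"
    using assms[OF t(1,2)] by (simp add: algebra_simps power2_eq_square)
  then have "0 \<le> a + t * b"
    using t(1) by (simp add: zero_le_mult_iff)
  moreover have "t * b \<le> t * (\<bar>b\<bar> + 1)"
    using t(1) by (intro mult_left_mono) auto
  ultimately show "0 \<le> a + e"
    using t(3) by linarith
qed

lemma Cauchy_prodI:
  fixes X :: "nat \<Rightarrow> 'a::metric_space" and Y :: "nat \<Rightarrow> 'b::metric_space"
  assumes "Cauchy X" "Cauchy Y"
  shows "Cauchy (\<lambda>n. (X n, Y n))"
proof (rule metric_CauchyI)
  fix e :: real assume "e > 0"
  then have "e / 2 > 0"
    by simp
  then obtain M N where M: "\<And>m n. m \<ge> M \<Longrightarrow> n \<ge> M \<Longrightarrow> dist (X m) (X n) < e / 2"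
    and N: "\<And>m n. m \<ge> N \<Longrightarrow> n \<ge> N \<Longrightarrow> dist (Y m) (Y n) < e / 2"
    using metric_CauchyD[OF assms(1)] metric_CauchyD[OF assms(2)] by meson
  have "dist (X m, Y m) (X n, Y n) < e" if "m \<ge> max M N" "n \<ge> max M N" for m n
    using M[of m n] N[of m n] that sqrt_sum_squares_le_sum[of "dist (X m) (X n)" "dist (Y m) (Y n)"]
    by (simp add: dist_Pair_Pair)
  then show "\<exists>M. \<forall>m\<ge>M. \<forall>n\<ge>M. dist (X m, Y m) (X n, Y n) < e"
    by blast
qed

text \<open>By the parallelogram law a minimizing sequence of \<open>r + \<parallel>p\<parallel>\<^sup>2 / 2\<close> is Cauchy; the conclusion is
  the first-order optimality condition at its limit.\<close>

lemma quadratic_minimizer_exists: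
  fixes E :: "('a::real_inner \<times> real) set"
  assumes E: "complete E" "convex E" "E \<noteq> {}"
    and bound: "\<And>p r. (p, r) \<in> E \<Longrightarrow> c \<le> r + (norm p)\<^sup>2 / 2"
  shows "\<exists>p r. (p, r) \<in> E \<and> (\<forall>p' r'. (p', r') \<in> E \<longrightarrow> 0 \<le> p \<bullet> (p' - p) + (r' - r))"
proof -
  \<comment> \<open>\<open>E\<close> stands for the epigraph of a convex function that may take the
    value \<infinity>: lower semicontinuity becomes completeness of \<open>E\<close>.
    \<open>F\<close> adds the quadratic.\<close>
  define F where "F = (\<lambda>e::'a \<times> real. snd e + (norm (fst e))\<^sup>2 / 2)"
  define I where "I = Inf (F ` E)"
  have bdd: "bdd_below (F ` E)"
    using bound by (auto simp: F_def intro!: bdd_belowI[of _ c])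
  have I_le: "I \<le> F e" if "e \<in> E" for e
    unfolding I_def using bdd that by (intro cInf_lower) auto
  have "\<exists>e\<in>E. F e < I + 1 / Suc n" for n
    using cInf_lessD[of "F ` E" "I + 1 / Suc n"] E(3) by (auto simp: I_def)
  then obtain s where s: "\<And>n. s n \<in> E" "\<And>n. F (s n) < I + 1 / Suc n"
    by metis
  have mid: "(norm (fst e - fst e'))\<^sup>2 \<le> 4 * (F e + F e' - 2 * I)" if "e \<in> E" "e' \<in> E" for e e'
  proof -
    have "(1/2) *\<^sub>R e + (1/2) *\<^sub>R e' \<in> E"
      using E(2) that by (intro convexD) auto
    from I_le[OF this] show ?thesis
      unfolding F_def
      by (simp add: power2_norm_eq_inner inner_simps inner_commute[of "fst e'" "fst e"] field_simps)
  qed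
  have F_lim: "(\<lambda>n. F (s n)) \<longlonglongrightarrow> I"
  proof (rule real_tendsto_sandwich[of "\<lambda>_. I" _ _ "\<lambda>n. I + 1 / Suc n"])
    show "(\<lambda>n. I + 1 / Suc n) \<longlonglongrightarrow> I"
      using tendsto_add[OF tendsto_const LIMSEQ_inverse_real_of_nat, of I]
      by (simp add: inverse_eq_divide)
  qed (use s I_le in \<open>auto intro!: always_eventually less_imp_le\<close>)
  have "Cauchy (\<lambda>n. fst (s n))"
  proof (rule metric_CauchyI)
    fix e :: real
    assume "e > 0"
    then have "\<forall>\<^sub>F n in sequentially. F (s n) < I + e\<^sup>2 / 8"
      using order_tendstoD(2)[OF F_lim, of "I + e\<^sup>2 / 8"] by simp
    then obtain M where M: "\<And>n. n \<ge> M \<Longrightarrow> F (s n) < I + e\<^sup>2 / 8"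
      by (auto simp: eventually_sequentially)
    have "dist (fst (s n)) (fst (s k)) < e" if "n \<ge> M" "k \<ge> M" for n k
    proof -
      have "(norm (fst (s n) - fst (s k)))\<^sup>2 < e\<^sup>2"
      proof -
        have "F (s n) + F (s k) - 2 * I < e\<^sup>2 / 4"
          using M[OF that(1)] M[OF that(2)] by (simp add: field_simps)
        then show ?thesis
          using mid[OF s(1) s(1), of n k] by (simp add: field_simps)
      qed
      then show ?thesis
        using \<open>e > 0\<close> by (simp add: dist_norm power_less_imp_less_base)
    qed
    then show "\<exists>M. \<forall>m\<ge>M. \<forall>n\<ge>M. dist (fst (s m)) (fst (s n)) < e"
      by blast
  qed
  \<comment> \<open>The heights converge as the difference of the convergent values
    \<open>F (s n)\<close> and half the squared norms.\<close>
  moreover have "Cauchy (\<lambda>n. snd (s n))"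
  proof -
    obtain R where R: "\<And>n. norm (fst (s n)) \<le> R" "R > 0"
      using \<open>Cauchy (\<lambda>n. fst (s n))\<close> cauchy_imp_bounded[of "\<lambda>n. fst (s n)"]
      by (metis bounded_pos rangeI)
    have "Cauchy (\<lambda>n. norm (fst (s n)))"
    proof (rule metric_CauchyI)
      fix e :: real assume "e > 0"
      with \<open>Cauchy (\<lambda>n. fst (s n))\<close> obtain M
        where "\<And>n k. n \<ge> M \<Longrightarrow> k \<ge> M \<Longrightarrow> dist (fst (s n)) (fst (s k)) < e"
        unfolding Cauchy_def by blast
      moreover have "dist (norm (fst (s n))) (norm (fst (s k))) \<le> dist (fst (s n)) (fst (s k))" for n k
        by (simp add: dist_norm norm_triangle_ineq3)
      ultimately show "\<exists>M. \<forall>n\<ge>M. \<forall>k\<ge>M. dist (norm (fst (s n))) (norm (fst (s k))) < e"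
        by (meson le_less_trans)
    qed
    then obtain l where "(\<lambda>n. norm (fst (s n))) \<longlonglongrightarrow> l"
      using real_Cauchy_convergent convergent_def by blast
    then have "(\<lambda>n. F (s n) - (norm (fst (s n)))\<^sup>2 / 2) \<longlonglongrightarrow> I - l\<^sup>2 / 2"
      using F_lim by (intro tendsto_intros) auto
    then show ?thesis
      using LIMSEQ_imp_Cauchy by (simp add: F_def)
  qed
  ultimately have "Cauchy (\<lambda>n. (fst (s n), snd (s n)))"
    by (rule Cauchy_prodI)
  then have "Cauchy s"
    by simp
  then obtain e where e: "e \<in> E" "s \<longlonglongrightarrow> e"
    using E(1) s(1) unfolding complete_def by blast
  have "(\<lambda>n. F (s n)) \<longlonglongrightarrow> F e"
    unfolding F_def using e(2) by (intro tendsto_intros) auto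
  then have Fe: "F e = I"
    using F_lim LIMSEQ_unique by blast
  have "0 \<le> fst e \<bullet> (p' - fst e) + (r' - snd e)" if "(p', r') \<in> E" for p' r'
  proof (rule nonneg_slope_of_nonneg_quadratic)
    fix t :: real assume t: "0 < t" "t \<le> 1"
    have "(1 - t) *\<^sub>R e + t *\<^sub>R (p', r') \<in> E"
      using E(2) e(1) that t by (intro convexD) auto
    then have "F e \<le> F ((1 - t) *\<^sub>R e + t *\<^sub>R (p', r'))"
      using I_le Fe by simp
    then show "0 \<le> t * (fst e \<bullet> (p' - fst e) + (r' - snd e)) + t\<^sup>2 * ((norm (p' - fst e))\<^sup>2 / 2)"
      unfolding F_def power2_norm_eq_inner
      by (simp add: inner_simps inner_commute[of p' "fst e"] power2_eq_square field_simps)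
  qed
  with e(1) show ?thesis
    by (intro exI[of _ "fst e"] exI[of _ "snd e"]) simp
qed

lemma complete_Times_set:
  fixes K :: "'a::metric_space set" and S :: "'b::metric_space set"
  assumes "complete K" "complete S"
  shows "complete (K \<times> S)"
proof (rule completeI)
  fix f :: "nat \<Rightarrow> 'a \<times> 'b"
  assume f: "\<forall>n. f n \<in> K \<times> S" "Cauchy f"
  have "Cauchy (\<lambda>n. fst (f n))" "Cauchy (\<lambda>n. snd (f n))"
    using f(2) by (auto intro: Cauchy_fst Cauchy_snd)
  then obtain a b where "a \<in> K" "(\<lambda>n. fst (f n)) \<longlonglongrightarrow> a" "b \<in> S" "(\<lambda>n. snd (f n)) \<longlonglongrightarrow> b"
    using assms f(1) unfolding complete_def by (metis mem_Times_iff)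
  then show "\<exists>l\<in>K \<times> S. f \<longlonglongrightarrow> l"
    using tendsto_Pair[of "\<lambda>n. fst (f n)" a sequentially "\<lambda>n. snd (f n)" b] by auto
qed

text \<open>Minimizing \<open>- f p\<close> plus half the squared norm over \<open>K\<close> gives
  the representing vector itself, because the derivative of the objective must vanish on a
  subspace.\<close>

lemma riesz_representation:
  fixes f :: "'a::real_inner \<Rightarrow> real"
  assumes K: "subspace K" "complete K"
    and lin: "\<And>a b. a \<in> K \<Longrightarrow> b \<in> K \<Longrightarrow> f (a + b) = f a + f b"
      "\<And>c a. a \<in> K \<Longrightarrow> f (c *\<^sub>R a) = c * f a"
    and bound: "\<And>a. a \<in> K \<Longrightarrow> \<bar>f a\<bar> \<le> R * norm a"
  obtains l where "l \<in> K" "\<And>a. a \<in> K \<Longrightarrow> f a = a \<bullet> l"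
proof -
  define E where "E = {(p, r). p \<in> K \<and> - f p \<le> r}"
  have f_diff: "f (a - b) = f a - f b" if "a \<in> K" "b \<in> K" for a b
    using lin(1)[of a "- b"] lin(2)[of b "-1"] that K(1) by (simp add: subspace_neg)
  have "complete E"
  proof (rule completeI)
    fix s assume s: "\<forall>n. s n \<in> E" "Cauchy s"
    have "complete (K \<times> (UNIV :: real set))"
      using K(2) by (intro complete_Times_set complete_UNIV)
    moreover have "\<forall>n. s n \<in> K \<times> UNIV"
      using s(1) by (auto simp: E_def mem_Times_iff split_beta)
    ultimately obtain e where "e \<in> K \<times> UNIV" "s \<longlonglongrightarrow> e"
      using s(2) unfolding complete_def by blast
    then obtain p r where pr: "p \<in> K" "s \<longlonglongrightarrow> (p, r)"
      by auto
    have lim: "(\<lambda>n. fst (s n)) \<longlonglongrightarrow> p" "(\<lambda>n. snd (s n)) \<longlonglongrightarrow> r"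
      using tendsto_fst[OF pr(2)] tendsto_snd[OF pr(2)] by auto
    have sK: "fst (s n) \<in> K" "- f (fst (s n)) \<le> snd (s n)" for n
      using s(1)[rule_format, of n] by (auto simp: E_def)
    have "(\<lambda>n. f (fst (s n))) \<longlonglongrightarrow> f p"
    proof (rule Lim_transform_bound[where g = "\<lambda>n. R * norm (fst (s n) - p)", THEN LIM_zero_cancel])
      show "\<forall>\<^sub>F n in sequentially. norm (f (fst (s n)) - f p) \<le> norm (R * norm (fst (s n) - p))"
      proof (intro always_eventually allI)
        fix n
        have "\<bar>f (fst (s n) - p)\<bar> \<le> R * norm (fst (s n) - p)"
          using bound sK pr(1) K(1) by (simp add: subspace_diff)
        then show "norm (f (fst (s n)) - f p) \<le> norm (R * norm (fst (s n) - p))"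
          using f_diff[OF sK(1)[of n] pr(1)] by simp
      qed
      show "(\<lambda>n. R * norm (fst (s n) - p)) \<longlonglongrightarrow> 0"
        using lim(1) by (intro tendsto_mult_right_zero tendsto_norm_zero) (simp add: LIM_zero)
    qed
    then have "- f p \<le> r"
      using LIMSEQ_le[OF tendsto_minus lim(2)] sK(2) by blast
    with pr show "\<exists>l\<in>E. s \<longlonglongrightarrow> l"
      by (auto simp: E_def)
  qed
  moreover have "convex E"
  proof (rule convexI)
    fix e e' and u w :: real
    assume *: "e \<in> E" "e' \<in> E" "0 \<le> u" "0 \<le> w" "u + w = 1"
    obtain p r p' r' where [simp]: "e = (p, r)" "e' = (p', r')"
      by (metis surj_pair)
    have "u * - f p \<le> u * r" "w * - f p' \<le> w * r'"
      using * by (intro mult_left_mono; simp add: E_def)+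
    then show "u *\<^sub>R e + w *\<^sub>R e' \<in> E"
      using * K(1) lin by (auto simp: E_def subspace_add subspace_scale)
  qed
  moreover have "E \<noteq> {}"
    using K(1) by (auto simp: E_def subspace_0 intro: exI[of _ 0])
  \<comment> \<open>Completing the square: \<open>- R\<^sup>2 / 2\<close> is the minimum of
    \<open>- R * s + s\<^sup>2 / 2\<close> over real \<open>s\<close>.\<close>
  moreover have "- R\<^sup>2 / 2 \<le> r + (norm p)\<^sup>2 / 2" if "(p, r) \<in> E" for p r
  proof -
    have "- R * norm p \<le> r"
      using that bound[of p] by (auto simp: E_def)
    moreover have "0 \<le> (norm p - R)\<^sup>2"
      by simp
    ultimately show ?thesis
      by (simp add: power2_eq_square algebra_simps)
  qed
  ultimately obtain p r where pr: "(p, r) \<in> E"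
    and vi: "\<And>p' r'. (p', r') \<in> E \<Longrightarrow> 0 \<le> p \<bullet> (p' - p) + (r' - r)"
    using quadratic_minimizer_exists[of E] by metis
  have p: "p \<in> K"
    using pr by (simp add: E_def)
  have *: "f a \<le> p \<bullet> a" if "a \<in> K" for a
  proof -
    have "(p + a, - f (p + a)) \<in> E"
      using p that K(1) by (simp add: E_def subspace_add)
    from vi[OF this] show ?thesis
      using pr lin(1)[OF p that] by (simp add: E_def)
  qed
  have "f a = a \<bullet> p" if "a \<in> K" for a
    using *[OF that] *[of "- a"] that K(1) lin(2)[OF that, of "-1"]
    by (simp add: subspace_neg inner_commute)
  with p show ?thesis
    by (rule that)
qed

section \<open>Maximally monotone operators\<close>

text \<open>The optimality condition at a minimizer of \<open>\<phi>(x, u) + \<parallel>(x, u)\<parallel>\<^sup>2 / 2\<close>, where \<open>\<phi>\<close> is the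
  Fitzpatrick function (given here by its epigraph), says that \<open>(- u, - x)\<close> is monotonically
  related to the whole graph.\<close>

lemma minty:
  fixes M :: "('a::real_inner \<times> 'a) set"
  assumes G: "subspace G" "complete G"
    and M: "M \<subseteq> G \<times> G"
    and mono: "\<And>x u y v. (x, u) \<in> M \<Longrightarrow> (y, v) \<in> M \<Longrightarrow> 0 \<le> (x - y) \<bullet> (u - v)"
    and max: "\<And>x u. x \<in> G \<Longrightarrow> u \<in> G \<Longrightarrow> (\<And>y v. (y, v) \<in> M \<Longrightarrow> 0 \<le> (x - y) \<bullet> (u - v)) \<Longrightarrow> (x, u) \<in> M"
  shows "\<exists>x. (x, - x) \<in> M"
proof -
  \<comment> \<open>One half-space per graph point; their intersection is the epigraph of the
    Fitzpatrick function, so closedness and convexity are immediate.\<close>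
  define H where "H = (\<lambda>(y, v). {(p, r). p \<bullet> (v, y) - r \<le> (y::'a) \<bullet> v})"
  define E where "E = ((G \<times> G) \<times> UNIV) \<inter> (\<Inter>e\<in>M. H e)"
  have E_iff: "((x, u), r) \<in> E \<longleftrightarrow> x \<in> G \<and> u \<in> G \<and> (\<forall>(y, v)\<in>M. x \<bullet> v + u \<bullet> y - y \<bullet> v \<le> r)" for x u r
    by (force simp: E_def H_def)
  have H_half: "H (y, v) = {e. ((v, y), -1) \<bullet> e \<le> y \<bullet> v}" for y v
    by (auto simp: H_def inner_commute)
  have "complete E"
    unfolding E_def using G(2)
    by (intro complete_Int_closed complete_Times_set complete_UNIV closed_INT ballI)
      (auto simp: H_half closed_halfspace_le)
  moreover have "convex E"
    unfolding E_def using subspace_imp_convex[OF G(1)]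
    by (intro convex_Int convex_Times convex_INT convex_UNIV)
      (auto simp: H_half convex_halfspace_le)
  moreover have "M \<noteq> {}"
    using max[of 0 0] G(1) by (auto simp: subspace_0)
  moreover have in_E: "((y, v), y \<bullet> v) \<in> E" if "(y, v) \<in> M" for y v
    unfolding E_iff using that M mono[OF that]
    by (force simp: inner_simps inner_commute)
  ultimately have E: "complete E" "convex E" "E \<noteq> {}"
    by auto
  \<comment> \<open>The Fitzpatrick function dominates the pairing: a pair outside \<open>M\<close>
    violates monotonicity against some \<open>(y, v)\<close>, and this candidate alone pushes the
    supremum above \<open>x \<bullet> u\<close>.\<close>
  have lower: "x \<bullet> u \<le> r" if "((x, u), r) \<in> E" for x u r
  proof (cases "(x, u) \<in> M")
    case True
    with that have "x \<bullet> u + u \<bullet> x - x \<bullet> u \<le> r"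
      unfolding E_iff by blast
    then show ?thesis
      by (simp add: inner_commute[of u x])
  next
    case False
    have "x \<in> G" "u \<in> G"
      using that by (auto simp: E_iff)
    with False max[of x u] obtain y v where "(y, v) \<in> M" "(x - y) \<bullet> (u - v) < 0"
      using not_le by blast
    moreover from this that have "x \<bullet> v + u \<bullet> y - y \<bullet> v \<le> r"
      unfolding E_iff by blast
    ultimately show ?thesis
      by (simp add: inner_simps inner_commute[of u y])
  qed
  have "0 \<le> r + (norm p)\<^sup>2 / 2" if "(p, r) \<in> E" for p r
  proof -
    obtain x u where p: "p = (x, u)"
      by (metis surj_pair)
    have "0 \<le> (norm (x + u))\<^sup>2"
      by simp
    then show ?thesis
      using lower[of x u r] that unfolding p
      by (simp add: power2_norm_eq_inner inner_simps inner_commute field_simps)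
  qed
  with E obtain p r where "(p, r) \<in> E"
    and vi: "\<And>p' r'. (p', r') \<in> E \<Longrightarrow> 0 \<le> p \<bullet> (p' - p) + (r' - r)"
    using quadratic_minimizer_exists[of E 0] by metis
  moreover obtain x u where p: "p = (x, u)"
    by (metis surj_pair)
  ultimately have xu: "((x, u), r) \<in> E"
    by simp
  \<comment> \<open>Optimality tested at \<open>((y, v), y \<bullet> v)\<close>, with
    \<open>x \<bullet> u \<le> r\<close>. The square is kept on the left because at the pair
    \<open>(- u, - x)\<close> the right side is 0, which forces \<open>u = - x\<close>.\<close>
  have *: "(norm (x + u))\<^sup>2 \<le> (- u - y) \<bullet> (- x - v)" if "(y, v) \<in> M" for y v
    using vi[OF in_E[OF that]] lower[OF xu] unfolding p
    by (simp add: power2_norm_eq_inner inner_simps inner_commute algebra_simps)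
  have "(- u, - x) \<in> M"
  proof (rule max)
    show "0 \<le> (- u - y) \<bullet> (- x - v)" if "(y, v) \<in> M" for y v
      using *[OF that] zero_le_power2 order_trans by blast
  qed (use xu G(1) in \<open>auto simp: E_iff subspace_neg\<close>)
  moreover from *[OF this] have "u = - x"
    by (simp add: eq_neg_iff_add_eq_0 add.commute)
  ultimately show ?thesis
    by auto
qed

text \<open>If a monotonically related pair were missing from the graph, adding it would give a
  proper monotone extension. Quantification over operators thus becomes a membership test.\<close>

lemma maximally_monotone_on_iff:
  "maximally_monotone_on G T \<longleftrightarrow> Gr T \<subseteq> G \<times> G \<and> monotone_op T \<and>
     (\<forall>x\<in>G. \<forall>u\<in>G. (\<forall>(y, v)\<in>Gr T. 0 \<le> (x - y) \<bullet> (u - v)) \<longrightarrow> u \<in> T x)"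
  (is "?L \<longleftrightarrow> ?R")
proof
  assume L: ?L
  have "u \<in> T x" if xu: "x \<in> G" "u \<in> G" "\<forall>(y, v)\<in>Gr T. 0 \<le> (x - y) \<bullet> (u - v)" for x u
  proof -
    define T' where "T' = (\<lambda>y. if y = x then insert u (T y) else T y)"
    have Gr': "Gr T' = insert (x, u) (Gr T)"
      by (auto simp: Gr_def T'_def split: if_splits)
    have "0 \<le> (y - x) \<bullet> (v - u)" if "(y, v) \<in> Gr T" for y v
      using xu(3) that by (force simp: inner_simps)
    then have "monotone_op T'"
      using L xu(3) unfolding monotone_op_def Gr' maximally_monotone_on_def by auto
    moreover have "Gr T' \<subseteq> G \<times> G" "Gr T \<subseteq> Gr T'"
      using L xu unfolding Gr' maximally_monotone_on_def by auto
    ultimately have "Gr T' = Gr T"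
      using L unfolding maximally_monotone_on_def by blast
    then show ?thesis
      unfolding Gr' by (auto simp: Gr_def)
  qed
  with L show ?R
    unfolding maximally_monotone_on_def by blast
next
  assume R: ?R
  have "Gr T' = Gr T" if T': "monotone_op T'" "Gr T' \<subseteq> G \<times> G" "Gr T \<subseteq> Gr T'" for T'
  proof (rule antisym[OF _ T'(3)], rule subsetI, clarify)
    fix x u assume xu: "(x, u) \<in> Gr T'"
    then have "\<forall>(y, v)\<in>Gr T. 0 \<le> (x - y) \<bullet> (u - v)"
      using T'(1,3) unfolding monotone_op_def by blast
    with R xu T'(2) show "(x, u) \<in> Gr T"
      by (auto simp: Gr_def)
  qed
  with R show ?L
    unfolding maximally_monotone_on_def by blast
qed

lemma monotone_opD:
  "monotone_op T \<Longrightarrow> u \<in> T x \<Longrightarrow> v \<in> T y \<Longrightarrow> 0 \<le> (x - y) \<bullet> (u - v)"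
  by (auto simp: monotone_op_def Gr_def)

lemma maximally_monotone_on_inv_op:
  assumes "maximally_monotone_on G T"
  shows "maximally_monotone_on G (inv_op T)"
proof -
  have *: "(x - y) \<bullet> (u - v) = (u - v) \<bullet> (x - y)" for x y u v :: 'a
    by (rule inner_commute)
  show ?thesis
    unfolding maximally_monotone_on_iff
  proof (intro conjI ballI impI)
    show "Gr (inv_op T) \<subseteq> G \<times> G"
      using assms by (auto simp: maximally_monotone_on_def Gr_def inv_op_def)
    show "monotone_op (inv_op T)"
      using assms unfolding maximally_monotone_on_def monotone_op_def Gr_def inv_op_def
      by (clarsimp, subst *) blast
    show "u \<in> inv_op T x" if "x \<in> G" "u \<in> G"
      "\<forall>(y, v)\<in>Gr (inv_op T). 0 \<le> (x - y) \<bullet> (u - v)" for x u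
    proof -
      have "\<forall>(y, v)\<in>Gr T. 0 \<le> (u - y) \<bullet> (x - v)"
        using that(3) unfolding Gr_def inv_op_def by (clarsimp, subst *) blast
      then show ?thesis
        using assms that unfolding maximally_monotone_on_iff inv_op_def by blast
    qed
  qed
qed

text \<open>\<open>minty\<close> is applied to the graph of \<open>t T - x\<close>: a pair
  \<open>(u, - u)\<close> in it solves \<open>u + t a = x\<close>.\<close>

lemma minty_surjective:
  assumes G: "subspace G" "complete G" and T: "maximally_monotone_on G T"
    and t: "t > 0" and x: "x \<in> G"
  obtains u a where "u \<in> G" "a \<in> T u" "u + t *\<^sub>R a = x"
proof -
  note TD = T[unfolded maximally_monotone_on_iff]
  have TG: "u \<in> G \<and> a \<in> G" if "a \<in> T u" for u a
    using TD that by (auto simp: Gr_def)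
  define M where "M = {(u, t *\<^sub>R a - x) | u a. a \<in> T u}"
  have "\<exists>u. (u, - u) \<in> M"
  proof (rule minty[OF G])
    show "M \<subseteq> G \<times> G"
      using TG G(1) x by (auto simp: M_def subspace_diff subspace_scale)
    show "0 \<le> (a - b) \<bullet> (c - d)" if "(a, c) \<in> M" "(b, d) \<in> M" for a b c d
      using that monotone_opD[of T] TD t
      by (auto simp: M_def real_vector.scale_right_diff_distrib[symmetric])
    show "(u, b) \<in> M" if u: "u \<in> G" and b: "b \<in> G"
      and rel: "\<And>y v. (y, v) \<in> M \<Longrightarrow> 0 \<le> (u - y) \<bullet> (b - v)" for u b
    proof -
      define a where "a = (1 / t) *\<^sub>R (b + x)"
      have b_eq: "b = t *\<^sub>R a - x"
        using t by (simp add: a_def)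
      have "0 \<le> (u - y) \<bullet> (a - v)" if "v \<in> T y" for y v
      proof -
        have "0 \<le> (u - y) \<bullet> (t *\<^sub>R (a - v))"
          using rel[of y "t *\<^sub>R v - x"] that by (auto simp: M_def b_eq algebra_simps)
        with t show ?thesis
          by (simp add: zero_le_mult_iff)
      qed
      moreover have "a \<in> G"
        using b x G(1) by (simp add: a_def subspace_add subspace_scale)
      ultimately have "a \<in> T u"
        using TD u by (auto simp: Gr_def)
      then show ?thesis
        by (auto simp: M_def b_eq)
    qed
  qed
  then obtain u a where "a \<in> T u" "- u = t *\<^sub>R a - x"
    by (auto simp: M_def)
  then have "u + t *\<^sub>R a = x"
    by (metis add.commute add_diff_cancel_left' add_uminus_conv_diff diff_add_cancel minus_diff_eq)
  with \<open>a \<in> T u\<close> TG that show ?thesis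
    by blast
qed

text \<open>Makes the \<open>THE\<close> in \<open>resolvent\<close> usable:
  \<open>minty_surjective\<close> gives a solution and monotonicity makes it unique. Later arguments
  work with the resulting inclusion and never unfold \<open>resolvent\<close>.\<close>

lemma resolvent_scale_op:
  assumes G: "subspace G" "complete G" and T: "maximally_monotone_on G T"
    and t: "t > 0" and x: "x \<in> G"
  obtains a where "resolvent (scale_op t T) x \<in> G" "a \<in> T (resolvent (scale_op t T) x)"
    "resolvent (scale_op t T) x + t *\<^sub>R a = x"
proof -
  have mono: "monotone_op T"
    using T by (simp add: maximally_monotone_on_def)
  obtain u a where ua: "u \<in> G" "a \<in> T u" "u + t *\<^sub>R a = x"
    using minty_surjective[OF assms] .
  have "resolvent (scale_op t T) x = u"
    unfolding resolvent_def
  proof (rule the_equality)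
    show "u \<in> inv_op (\<lambda>w. {w} + scale_op t T w) x"
      using ua by (auto simp: inv_op_def scale_op_def set_plus_def)
  next
    fix w assume "w \<in> inv_op (\<lambda>w. {w} + scale_op t T w) x"
    then obtain b where b: "b \<in> T w" "w + t *\<^sub>R b = x"
      by (auto simp: inv_op_def scale_op_def set_plus_def)
    have "w - u = t *\<^sub>R (a - b)"
      using b(2) ua(3) by (metis add_diff_eq diff_add_eq diff_eq_eq scaleR_right_diff_distrib add.commute)
    then have "(w - u) \<bullet> (w - u) = - t * ((w - u) \<bullet> (b - a))"
      by (metis inner_minus_right inner_scaleR_right minus_diff_eq mult_minus_left mult_minus_right)
    also have "\<dots> \<le> 0"
      using monotone_opD[OF mono b(1) ua(2)] t by simp
    finally show "w = u"
      by (metis inner_eq_zero_iff inner_ge_zero order_antisym right_minus_eq)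
  qed
  with ua show ?thesis
    by (intro that[of a]) auto
qed

section \<open>Weak convergence\<close>

text \<open>Tychonoff's theorem gives a pointwise limit of the functionals \<open>\<lambda>w. z n \<bullet> w\<close> along a finer
  filter; filters spare the extraction of weakly convergent subsequences.\<close>

lemma weak_cluster_point:
  fixes z :: "'i \<Rightarrow> 'a::real_inner"
  assumes K: "subspace K" "complete K"
    and z: "\<And>n. norm (z n) \<le> R" and F: "F \<noteq> bot"
  shows "\<exists>F' l. F' \<le> F \<and> F' \<noteq> bot \<and> l \<in> K \<and> (\<forall>w\<in>K. ((\<lambda>n. z n \<bullet> w) \<longlongrightarrow> l \<bullet> w) F')"
proof -
  define g where "g = (\<lambda>n w. z n \<bullet> w)"
  define U where "U = Pi\<^sub>E UNIV (\<lambda>w::'a. {- (R * norm w)..R * norm w})"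
  have "compactin (product_topology (\<lambda>_. euclidean) UNIV) U"
    unfolding U_def compactin_PiE by simp
  then have "compact U"
    by (simp add: euclidean_product_topology)
  moreover have "\<bar>z n \<bullet> w\<bar> \<le> R * norm w" for n w
    using Cauchy_Schwarz_ineq2[of "z n" w] mult_right_mono[OF z[of n], of "norm w"] by simp
  then have "g n \<in> U" for n
    by (auto simp: g_def U_def abs_le_iff) (smt (verit, best))
  then have "\<forall>\<^sub>F f in filtermap g F. f \<in> U"
    by (simp add: eventually_filtermap)
  moreover have "filtermap g F \<noteq> bot"
    using F by (simp add: filtermap_bot_iff)
  ultimately obtain f where f: "f \<in> U" "inf (nhds f) (filtermap g F) \<noteq> bot"
    unfolding compact_filter by blast
  \<comment> \<open>The cluster point \<open>f\<close> belongs to the image filter; pulling its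
    neighbourhoods back along \<open>g\<close> turns it into a limit along an index filter finer
    than \<open>F\<close>.\<close>
  define F' where "F' = inf F (filtercomap g (nhds f))"
  have F'_bot: "F' \<noteq> bot"
  proof
    assume "F' = bot"
    then have "\<forall>\<^sub>F n in F'. False"
      by simp
    then obtain P Q where PQ: "eventually P F" "eventually Q (filtercomap g (nhds f))"
      "\<And>n. P n \<Longrightarrow> Q n \<Longrightarrow> False"
      unfolding F'_def eventually_inf by blast
    then obtain Q' where Q': "eventually Q' (nhds f)" "\<And>n. Q' (g n) \<Longrightarrow> Q n"
      unfolding eventually_filtercomap by blast
    have "eventually (\<lambda>h. \<exists>n. P n \<and> h = g n) (filtermap g F)"
      using PQ(1) unfolding eventually_filtermap by (rule eventually_mono) blast
    with Q'(1) have "\<forall>\<^sub>F h in inf (nhds f) (filtermap g F). False"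
      unfolding eventually_inf using PQ(3) Q'(2) by blast
    with f(2) show False
      by (simp add: eventually_False)
  qed
  have "filterlim g (nhds f) F'"
    unfolding filterlim_iff_le_filtercomap F'_def by simp
  then have lim: "((\<lambda>n. z n \<bullet> w) \<longlongrightarrow> f w) F'" for w
    using continuous_on_tendsto_compose[OF continuous_on_product_coordinates[of w], of g f F']
    by (simp add: g_def)
  have f_bound: "\<bar>f w\<bar> \<le> R * norm w" for w
    using f(1) by (auto simp: U_def PiE_iff abs_le_iff) (smt (verit, best))
  have "f (a + b) = f a + f b" for a b
    using tendsto_add[OF lim lim, of a b] lim[of "a + b"] tendsto_unique[OF F'_bot]
    by (simp add: inner_add_right)
  moreover have "f (c *\<^sub>R a) = c * f a" for c a
    using tendsto_mult_left[OF lim, of c a] lim[of "c *\<^sub>R a"] tendsto_unique[OF F'_bot]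
    by simp
  ultimately obtain l where l: "l \<in> K" "\<And>a. a \<in> K \<Longrightarrow> f a = a \<bullet> l"
    using riesz_representation[OF K, of f R] f_bound by metis
  have "\<forall>w\<in>K. ((\<lambda>n. z n \<bullet> w) \<longlongrightarrow> l \<bullet> w) F'"
    using lim l(2) by (metis inner_commute)
  moreover have "F' \<le> F"
    by (simp add: F'_def)
  ultimately show ?thesis
    using F'_bot l(1) by blast
qed

text \<open>Two cluster points \<open>l\<close>, \<open>l'\<close> agree because
  \<open>z n \<bullet> (l' - l)\<close> has a limit along the whole sequence, which must equal both
  \<open>l' \<bullet> (l' - l)\<close> and \<open>l \<bullet> (l' - l)\<close>.\<close>

lemma opial_convergence:
  fixes z :: "nat \<Rightarrow> 'a::real_inner"
  assumes K: "subspace K" "complete K" and S: "S \<subseteq> K"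
    and z: "\<And>n. norm (z n) \<le> R"
    and cluster: "\<And>F l. F \<noteq> bot \<Longrightarrow> F \<le> sequentially \<Longrightarrow> l \<in> K \<Longrightarrow>
      (\<And>w. w \<in> K \<Longrightarrow> ((\<lambda>n. z n \<bullet> w) \<longlongrightarrow> l \<bullet> w) F) \<Longrightarrow> l \<in> S"
    and gap: "\<And>a b. a \<in> S \<Longrightarrow> b \<in> S \<Longrightarrow> convergent (\<lambda>n. z n \<bullet> (a - b))"
  shows "\<exists>l\<in>S. \<forall>w\<in>K. (\<lambda>n. z n \<bullet> w) \<longlonglongrightarrow> l \<bullet> w"
proof -
  obtain F0 l where F0: "F0 \<le> sequentially" "F0 \<noteq> bot" "l \<in> K"
    "\<forall>w\<in>K. ((\<lambda>n. z n \<bullet> w) \<longlongrightarrow> l \<bullet> w) F0"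
    using weak_cluster_point[OF K, of z R sequentially] z sequentially_bot by blast
  then have l: "l \<in> S"
    using cluster by blast
  have unique: "l' = l" if F: "F \<le> sequentially" "F \<noteq> bot" "l' \<in> K"
    "\<forall>w\<in>K. ((\<lambda>n. z n \<bullet> w) \<longlongrightarrow> l' \<bullet> w) F" for F l'
  proof -
    have l': "l' \<in> S"
      using F cluster by blast
    then obtain c where c: "(\<lambda>n. z n \<bullet> (l' - l)) \<longlonglongrightarrow> c"
      using gap[OF _ l] unfolding convergent_def by blast
    have d: "l' - l \<in> K"
      using K(1) F(3) F0(3) by (rule subspace_diff)
    have "c = l' \<bullet> (l' - l)"
      using tendsto_unique[OF F(2) tendsto_mono[OF F(1) c]] F(4) d by blast
    moreover have "c = l \<bullet> (l' - l)"
      using tendsto_unique[OF F0(2) tendsto_mono[OF F0(1) c]] F0(4) d by blast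
    ultimately have "(l' - l) \<bullet> (l' - l) = 0"
      by (simp add: inner_diff_left)
    then show ?thesis
      by simp
  qed
  have "(\<lambda>n. z n \<bullet> w) \<longlonglongrightarrow> l \<bullet> w" if w: "w \<in> K" for w
  proof (rule tendstoI, rule ccontr)
    fix e :: real
    assume "e > 0" and not_ev: "\<not> (\<forall>\<^sub>F n in sequentially. dist (z n \<bullet> w) (l \<bullet> w) < e)"
    \<comment> \<open>If convergence fails, the indices violating the \<open>e\<close>-bound carry a
      proper filter. It has a cluster point, which by uniqueness is \<open>l\<close>, although the
      values stay away from \<open>l \<bullet> w\<close>.\<close>
    define F where "F = inf sequentially (principal {n. \<not> dist (z n \<bullet> w) (l \<bullet> w) < e})"
    have "F \<noteq> bot"
      using not_ev by (simp add: F_def trivial_limit_def eventually_inf_principal)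
    then obtain F' l' where F': "F' \<le> F" "F' \<noteq> bot" "l' \<in> K"
      "\<forall>w\<in>K. ((\<lambda>n. z n \<bullet> w) \<longlongrightarrow> l' \<bullet> w) F'"
      using weak_cluster_point[OF K, of z R F] z by blast
    have "F' \<le> sequentially"
      using F'(1) by (simp add: F_def)
    with F' have "l' = l"
      using unique by blast
    with F'(4) w \<open>e > 0\<close> have "\<forall>\<^sub>F n in F'. dist (z n \<bullet> w) (l \<bullet> w) < e"
      by (auto dest: tendstoD)
    moreover have "\<forall>\<^sub>F n in F'. \<not> dist (z n \<bullet> w) (l \<bullet> w) < e"
      using F'(1) unfolding F_def by (simp add: le_principal)
    ultimately have "\<forall>\<^sub>F n in F'. False"
      by eventually_elim simp
    with F'(2) show False
      by (simp add: eventually_False)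
  qed
  with l show ?thesis
    by blast
qed

section \<open>Real sequences\<close>

lemma sum_at_top_of_not_summable:
  fixes lam :: "nat \<Rightarrow> real"
  assumes pos: "\<And>n. 0 \<le> lam n" and "\<not> summable lam"
  shows "filterlim (\<lambda>n. \<Sum>k\<le>n. lam k) at_top sequentially"
  unfolding filterlim_at_top
proof
  fix b
  obtain N where N: "b < (\<Sum>k<N. lam k)"
  proof -
    have "\<exists>N. b < (\<Sum>k<N. lam k)"
    proof (rule ccontr)
      assume "\<nexists>N. b < (\<Sum>k<N. lam k)"
      then have "(\<Sum>k<N. lam k) \<le> b" for N
        by (simp add: not_less)
      with pos have "summable lam"
        by (rule summableI_nonneg_bounded)
      with assms(2) show False ..
    qed
    with that show thesis
      by blast
  qed
  show "\<forall>\<^sub>F n in sequentially. b \<le> (\<Sum>k\<le>n. lam k)"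
    using eventually_ge_at_top[of N]
  proof eventually_elim
    case (elim n)
    have "(\<Sum>k<N. lam k) \<le> (\<Sum>k\<le>n. lam k)"
      using elim pos by (intro sum_mono2) auto
    with N show ?case
      by simp
  qed
qed

text \<open>A Toeplitz argument: the terms before \<open>N\<close> contribute at most a fixed
  \<open>b\<close>, which the diverging weight sum absorbs, and the remaining ones deviate by at
  most \<open>e / 2\<close> on average.\<close>

lemma weighted_cesaro:
  fixes lam r :: "nat \<Rightarrow> real"
  assumes pos: "\<And>n. 0 < lam n" and div: "\<not> summable lam" and r: "r \<longlonglongrightarrow> c"
  shows "(\<lambda>n. (\<Sum>k\<le>n. lam k * r k) / (\<Sum>k\<le>n. lam k)) \<longlonglongrightarrow> c"
proof (rule LIM_zero_cancel, rule LIMSEQ_I)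
  fix e :: real
  assume "e > 0"
  define T where "T = (\<lambda>n. \<Sum>k\<le>n. lam k)"
  have T_pos: "T n > 0" for n
    unfolding T_def using pos by (intro sum_pos) auto
  have T_top: "filterlim T at_top sequentially"
    unfolding T_def using pos div by (intro sum_at_top_of_not_summable) (auto intro: less_imp_le)
  obtain N where N: "\<And>n. n \<ge> N \<Longrightarrow> \<bar>r n - c\<bar> < e / 2"
    using LIMSEQ_D[OF r, of "e / 2"] \<open>e > 0\<close> by auto
  define b where "b = (\<Sum>k<N. lam k * \<bar>r k - c\<bar>)"
  have "b \<ge> 0"
    unfolding b_def using pos by (intro sum_nonneg mult_nonneg_nonneg) (auto intro: less_imp_le)
  have bound: "\<bar>\<Sum>k\<le>n. lam k * (r k - c)\<bar> \<le> b + e / 2 * T n" for n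
  proof -
    have "\<bar>\<Sum>k\<le>n. lam k * (r k - c)\<bar> \<le> (\<Sum>k\<le>n. lam k * \<bar>r k - c\<bar>)"
      using pos by (intro order_trans[OF sum_abs] sum_mono) (simp add: abs_mult less_imp_le)
    also have "\<dots> \<le> (\<Sum>k\<le>n. (if k < N then lam k * \<bar>r k - c\<bar> else 0) + e / 2 * lam k)"
    proof (intro sum_mono)
      fix k
      have "k \<ge> N \<Longrightarrow> lam k * \<bar>r k - c\<bar> \<le> lam k * (e / 2)"
        using N[of k] pos[of k] by (intro mult_left_mono) auto
      then show "lam k * \<bar>r k - c\<bar> \<le> (if k < N then lam k * \<bar>r k - c\<bar> else 0) + e / 2 * lam k"
        using pos[of k] \<open>e > 0\<close> by (auto simp: mult.commute)
    qed
    also have "\<dots> = (\<Sum>k\<in>{..n} \<inter> {..<N}. lam k * \<bar>r k - c\<bar>) + e / 2 * T n"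
      by (simp add: sum.distrib sum_distrib_left T_def sum.inter_restrict lessThan_iff cong: sum.cong)
    also have "\<dots> \<le> b + e / 2 * T n"
      unfolding b_def using pos
      by (intro add_right_mono sum_mono2) (auto simp: less_imp_le)
    finally show ?thesis .
  qed
  have "\<forall>\<^sub>F n in sequentially. 2 * b / e + 1 \<le> T n"
    using T_top unfolding filterlim_at_top by blast
  then obtain M where M: "\<And>n. n \<ge> M \<Longrightarrow> 2 * b / e + 1 \<le> T n"
    unfolding eventually_sequentially by blast
  have "\<bar>(\<Sum>k\<le>n. lam k * r k) / T n - c\<bar> < e" if "n \<ge> M" for n
  proof -
    have "b < e / 2 * T n"
      using M[OF that] \<open>e > 0\<close> by (simp add: field_simps)
    then have "\<bar>\<Sum>k\<le>n. lam k * (r k - c)\<bar> < e * T n"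
      using bound[of n] by simp
    moreover have "(\<Sum>k\<le>n. lam k * (r k - c)) = (\<Sum>k\<le>n. lam k * r k) - c * T n"
      by (simp add: T_def algebra_simps sum_subtractf sum_distrib_left)
    moreover have "(\<Sum>k\<le>n. lam k * r k) / T n - c = ((\<Sum>k\<le>n. lam k * r k) - c * T n) / T n"
      using T_pos[of n] by (simp add: field_simps)
    ultimately show ?thesis
      using T_pos[of n] by (simp add: abs_divide field_simps)
  qed
  then show "\<exists>M. \<forall>n\<ge>M. norm ((\<Sum>k\<le>n. lam k * r k) / (\<Sum>k\<le>n. lam k) - c - 0) < e"
    unfolding T_def by auto
qed

text \<open>Subtracting the partial sums of \<open>h\<close> from \<open>a\<close> leaves a
  decreasing sequence bounded below; telescoping its decrements bounds the partial sums of
  \<open>b\<close>. The shift by \<open>N\<close> skips the indices without descent.\<close>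

lemma quasi_fejer:
  fixes a b h :: "nat \<Rightarrow> real"
  assumes a: "\<And>n. 0 \<le> a n" and b: "\<And>n. 0 \<le> b n" and h: "summable h"
    and descent: "\<And>n. n \<ge> N \<Longrightarrow> a (Suc n) \<le> a n - b n + h n"
  shows "convergent a" "summable b"
proof -
  define s where "s = (\<lambda>n. \<Sum>k<n. h (k + N))"
  have "convergent s"
    using h unfolding s_def summable_iff_convergent[symmetric] by (subst summable_iff_shift)
  then obtain B where B: "\<And>n. \<bar>s n\<bar> \<le> B"
    using convergent_imp_Bseq[of s] unfolding Bseq_def by auto
  define c where "c = (\<lambda>n. a (n + N) - s n)"
  have step: "c (Suc n) \<le> c n - b (n + N)" for n
    using descent[of "n + N"] by (simp add: c_def s_def)
  have "c (Suc n) \<le> c n" for n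
    using step[of n] b[of "n + N"] by linarith
  then have "decseq c"
    by (intro decseq_SucI)
  moreover have c_lower: "- B \<le> c n" for n
    using a[of "n + N"] B[of n] unfolding c_def by linarith
  ultimately have "convergent c"
    by (metis convergent_def decseq_convergent)
  then have "convergent (\<lambda>n. c n + s n)"
    using \<open>convergent s\<close> by (rule convergent_add)
  then show "convergent a"
    unfolding c_def using convergent_ignore_initial_segment[of a N] by simp
  have "(\<Sum>k<n. b (k + N)) \<le> c 0 - c n" for n
  proof (induction n)
    case (Suc n)
    then show ?case
      using step[of n] by simp
  qed simp
  then have "(\<Sum>k<n. b (k + N)) \<le> c 0 + B" for n
    using c_lower[of n] by (smt (verit))
  then have "summable (\<lambda>k. b (k + N))"
    using b by (intro summableI_nonneg_bounded) auto
  then show "summable b"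
    by (simp add: summable_iff_shift)
qed

text \<open>A positive limit would give \<open>lam n \<le> 2 / c * (lam n * d n)\<close> eventually,
  and \<open>lam\<close> would be summable by comparison.\<close>

lemma limit_zero_of_summable_weighted:
  fixes lam d :: "nat \<Rightarrow> real"
  assumes pos: "\<And>n. 0 < lam n" and div: "\<not> summable lam"
    and sum: "summable (\<lambda>n. lam n * d n)" and d: "d \<longlonglongrightarrow> c" "\<And>n. 0 \<le> d n"
  shows "c = 0"
proof (rule ccontr)
  assume "c \<noteq> 0"
  moreover have "c \<ge> 0"
    using d LIMSEQ_le_const by blast
  ultimately have "\<forall>\<^sub>F n in sequentially. c / 2 < d n"
    using order_tendstoD(1)[OF d(1), of "c / 2"] by simp
  then have "\<forall>\<^sub>F n in sequentially. norm (lam n) \<le> 2 / c * (lam n * d n)"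
  proof eventually_elim
    case (elim n)
    have "lam n * (c / 2) \<le> lam n * d n"
      using elim pos[of n] by (intro mult_left_mono) auto
    with pos[of n] \<open>c \<noteq> 0\<close> \<open>c \<ge> 0\<close> show ?case
      by (simp add: field_simps)
  qed
  then have "summable lam"
    using summable_mult[OF sum] by (rule summable_comparison_test_ev)
  with div show False
    by simp
qed

section \<open>Ergodic convergence of a quasi-Fejer scheme\<close>

text \<open>\<open>S\<close> is the graph of the operator whose zero is sought. \<open>Y n\<close> is the paper's \<open>y\<^sub>n\<^sub>-\<^sub>1\<close>, which lets
  the index start at \<open>0\<close>.\<close>

locale ergodic_scheme =
  fixes K :: "'a::real_inner set" and S :: "('a \<times> 'a) set"
    and X Y :: "nat \<Rightarrow> 'a" and lam :: "nat \<Rightarrow> real" and \<kappa> :: real and N :: nat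
  assumes K: "subspace K" "complete K" and S: "S \<subseteq> K \<times> K"
    and lam: "\<And>n. 0 < lam n" "\<not> summable lam" and \<kappa>: "0 < \<kappa>"
    and step: "\<And>n. n \<ge> N \<Longrightarrow> norm (X (Suc n) - Y (Suc n)) \<le> norm (Y (Suc n) - Y n)"
    and descent: "\<And>u w. (u, w) \<in> S \<Longrightarrow> \<exists>h. summable h \<and> (\<forall>n\<ge>N.
      (norm (X (Suc n) - u))\<^sup>2 + (norm (X (Suc n) - Y (Suc n)))\<^sup>2
        \<le> (norm (X n - u))\<^sup>2 + (norm (X n - Y n))\<^sup>2 + 2 * lam n * (w \<bullet> (u - Y (Suc n)))
          + h n - \<kappa> * (norm (Y (Suc n) - Y n))\<^sup>2)"
    and ex_zero: "\<exists>u. (u, 0) \<in> S"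
    and maximal: "\<And>l. l \<in> K \<Longrightarrow> (\<And>u w. (u, w) \<in> S \<Longrightarrow> 0 \<le> w \<bullet> (u - l)) \<Longrightarrow> (l, 0) \<in> S"
begin

text \<open>At a zero the inner product term of \<open>descent\<close> vanishes, so the squared
  increments of \<open>Y\<close> are summable; \<open>step\<close> bounds the gap between
  \<open>X\<close> and \<open>Y\<close> by these increments.\<close>

lemma gaps_tendsto_zero:
  shows "(\<lambda>n. X n - Y n) \<longlonglongrightarrow> 0" "(\<lambda>n. Y (Suc n) - X n) \<longlonglongrightarrow> 0"
proof -
  obtain u where "(u, 0) \<in> S"
    using ex_zero by blast
  then obtain h where h: "summable h" and D: "\<And>n. n \<ge> N \<Longrightarrow>
      (norm (X (Suc n) - u))\<^sup>2 + (norm (X (Suc n) - Y (Suc n)))\<^sup>2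
        \<le> (norm (X n - u))\<^sup>2 + (norm (X n - Y n))\<^sup>2
          + h n - \<kappa> * (norm (Y (Suc n) - Y n))\<^sup>2"
    using descent[of u 0] by auto
  have "summable (\<lambda>n. \<kappa> * (norm (Y (Suc n) - Y n))\<^sup>2)"
    by (rule quasi_fejer(2)[OF _ _ h, where
          a = "\<lambda>n. (norm (X n - u))\<^sup>2 + (norm (X n - Y n))\<^sup>2" and N = N])
      (use D \<kappa> in \<open>auto simp: algebra_simps\<close>)
  then have "(\<lambda>n. \<kappa> * (norm (Y (Suc n) - Y n))\<^sup>2) \<longlonglongrightarrow> 0"
    by (rule summable_LIMSEQ_zero)
  then have "(\<lambda>n. (norm (Y (Suc n) - Y n))\<^sup>2) \<longlonglongrightarrow> 0"
    using tendsto_mult_left[of _ 0 _ "1 / \<kappa>"] \<kappa> by fastforce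
  then have d: "(\<lambda>n. norm (Y (Suc n) - Y n)) \<longlonglongrightarrow> 0"
    using tendsto_real_sqrt by fastforce
  have "(\<lambda>n. X (Suc n) - Y (Suc n)) \<longlonglongrightarrow> 0"
    using step by (intro Lim_null_comparison[OF _ d]) (auto simp: eventually_sequentially)
  then show XY: "(\<lambda>n. X n - Y n) \<longlonglongrightarrow> 0"
    by (rule LIMSEQ_imp_Suc)
  have "(\<lambda>n. (Y (Suc n) - Y n) - (X n - Y n)) \<longlonglongrightarrow> 0 - 0"
    using d XY by (intro tendsto_diff) (simp add: tendsto_norm_zero_iff)
  then show "(\<lambda>n. Y (Suc n) - X n) \<longlonglongrightarrow> 0"
    by simp
qed

lemma convergent_norm_diff_zero:
  assumes "(u, 0) \<in> S"
  shows "convergent (\<lambda>n. (norm (X n - u))\<^sup>2)"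
proof -
  obtain h where h: "summable h" and D: "\<And>n. n \<ge> N \<Longrightarrow>
      (norm (X (Suc n) - u))\<^sup>2 + (norm (X (Suc n) - Y (Suc n)))\<^sup>2
        \<le> (norm (X n - u))\<^sup>2 + (norm (X n - Y n))\<^sup>2
          + h n - \<kappa> * (norm (Y (Suc n) - Y n))\<^sup>2"
    using descent[OF assms] by auto
  have "convergent (\<lambda>n. (norm (X n - u))\<^sup>2 + (norm (X n - Y n))\<^sup>2)"
    by (rule quasi_fejer(1)[OF _ _ h, where
          b = "\<lambda>n. \<kappa> * (norm (Y (Suc n) - Y n))\<^sup>2" and N = N])
      (use D \<kappa> in \<open>auto simp: algebra_simps\<close>)
  moreover have "(\<lambda>n. (norm (X n - Y n))\<^sup>2) \<longlonglongrightarrow> 0\<^sup>2"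
    using gaps_tendsto_zero(1) by (intro tendsto_power tendsto_norm_zero)
  then have "convergent (\<lambda>n. (norm (X n - Y n))\<^sup>2)"
    by (rule convergentI)
  ultimately show ?thesis
    using convergent_diff by fastforce
qed

definition avg :: "nat \<Rightarrow> 'a" where
  "avg n = (1 / (\<Sum>k\<le>n. lam k)) *\<^sub>R (\<Sum>k\<le>n. lam k *\<^sub>R X k)"

lemma weight_sum_pos: "0 < (\<Sum>k\<le>n. lam k)"
  using lam(1) by (intro sum_pos) auto

lemma avg_inner: "avg n \<bullet> w = (\<Sum>k\<le>n. lam k * (X k \<bullet> w)) / (\<Sum>k\<le>n. lam k)"
  by (simp add: avg_def inner_sum_left)

lemma avg_bounded: "\<exists>R. \<forall>n. norm (avg n) \<le> R"
proof -
  obtain u where "(u, 0) \<in> S"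
    using ex_zero by blast
  then obtain R where R: "\<And>n. (norm (X n - u))\<^sup>2 \<le> R" "R > 0"
    using convergent_imp_Bseq[OF convergent_norm_diff_zero] unfolding Bseq_def by auto
  have X: "norm (X n) \<le> norm u + sqrt R" for n
  proof -
    have "norm (X n - u) \<le> sqrt R"
      using R(1)[of n] by (rule real_le_rsqrt)
    then show ?thesis
      using norm_triangle_ineq[of "X n - u" u] by simp
  qed
  have "norm (avg n) \<le> norm u + sqrt R" for n
  proof -
    have "norm (\<Sum>k\<le>n. lam k *\<^sub>R X k) \<le> (\<Sum>k\<le>n. lam k * (norm u + sqrt R))"
      using X lam(1) by (intro sum_norm_le) (auto intro!: mult_mono simp: less_imp_le)
    also have "\<dots> = (\<Sum>k\<le>n. lam k) * (norm u + sqrt R)"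
      by (simp add: sum_distrib_right)
    finally show ?thesis
      using weight_sum_pos[of n] by (simp add: avg_def field_simps)
  qed
  then show ?thesis
    by blast
qed

text \<open>The summed descent telescopes, so the sums of
  \<open>lam k * (w \<bullet> (u - Y (Suc k)))\<close> stay bounded below; division by the diverging
  weight sums turns this bound into 0. The vanishing gap lets \<open>X k\<close>, and hence the
  average, replace \<open>Y (Suc k)\<close>.\<close>

lemma cluster_point_is_zero:
  assumes F: "F \<noteq> bot" "F \<le> sequentially" and l: "l \<in> K"
    and lim: "\<And>w. w \<in> K \<Longrightarrow> ((\<lambda>n. avg n \<bullet> w) \<longlongrightarrow> l \<bullet> w) F"
  shows "(l, 0) \<in> S"
proof (rule maximal[OF l])
  fix u w assume uw: "(u, w) \<in> S"
  then have w: "w \<in> K"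
    using S by auto
  obtain h where h: "summable h" and D: "\<And>n. n \<ge> N \<Longrightarrow>
      (norm (X (Suc n) - u))\<^sup>2 + (norm (X (Suc n) - Y (Suc n)))\<^sup>2
        \<le> (norm (X n - u))\<^sup>2 + (norm (X n - Y n))\<^sup>2 + 2 * lam n * (w \<bullet> (u - Y (Suc n)))
          + h n - \<kappa> * (norm (Y (Suc n) - Y n))\<^sup>2"
    using descent[OF uw] by auto
  define T where "T = (\<lambda>n. \<Sum>k\<le>n. lam k)"
  define a where "a = (\<lambda>n. (norm (X n - u))\<^sup>2 + (norm (X n - Y n))\<^sup>2)"
  define f where "f = (\<lambda>n. 2 * lam n * (w \<bullet> (u - Y (Suc n))) + h n)"
  \<comment> \<open>\<open>b\<close> accounts for the indices before \<open>N\<close>, where no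
    descent is available, and for the starting value \<open>a N\<close>.\<close>
  define b where "b = (\<Sum>k<N. f k) - a N"
  have "b \<le> (\<Sum>k<n. f k)" if "n \<ge> N" for n
  proof -
    have "b + a n \<le> (\<Sum>k<n. f k)"
      using that
    proof (induction n rule: dec_induct)
      case (step n)
      have "0 \<le> \<kappa> * (norm (Y (Suc n) - Y n))\<^sup>2"
        using \<kappa> by simp
      then have "a (Suc n) \<le> a n + f n"
        using D[OF step(1)] unfolding a_def f_def by linarith
      with step show ?case
        by simp
    qed (simp add: b_def)
    then show ?thesis
      by (simp add: a_def) (smt (verit) zero_le_power2)
  qed
  moreover obtain B where B: "\<And>n. \<bar>\<Sum>k<n. h k\<bar> \<le> B"
    using convergent_imp_Bseq[OF h[unfolded summable_iff_convergent]] unfolding Bseq_def by auto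
  ultimately have "(b - B) / 2 \<le> (\<Sum>k\<le>n. lam k * (w \<bullet> (u - Y (Suc k))))" if "n \<ge> N" for n
  proof -
    have "b \<le> (\<Sum>k\<le>n. f k)"
      using \<open>\<And>n. n \<ge> N \<Longrightarrow> b \<le> (\<Sum>k<n. f k)\<close>[of "Suc n"] that by (simp add: lessThan_Suc_atMost)
    also have "\<dots> = 2 * (\<Sum>k\<le>n. lam k * (w \<bullet> (u - Y (Suc k)))) + (\<Sum>k<Suc n. h k)"
      unfolding lessThan_Suc_atMost by (simp add: f_def sum.distrib sum_distrib_left mult.assoc)
    finally show ?thesis
      using B[of "Suc n"] by (simp add: abs_le_iff)
  qed
  then have lower: "\<forall>\<^sub>F n in sequentially.
      (b - B) / 2 / T n \<le> (\<Sum>k\<le>n. lam k * (w \<bullet> (u - Y (Suc k)))) / T n"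
    unfolding eventually_sequentially T_def
    using less_imp_le[OF weight_sum_pos] by (intro exI[of _ N] allI impI divide_right_mono)
  have "filterlim T at_top sequentially"
    unfolding T_def using lam by (intro sum_at_top_of_not_summable) (auto simp: less_imp_le)
  then have "(\<lambda>n. (b - B) / 2 / T n) \<longlonglongrightarrow> 0"
    by (intro real_tendsto_divide_at_top[OF tendsto_const])
  moreover have "((\<lambda>n. (\<Sum>k\<le>n. lam k * (w \<bullet> (u - Y (Suc k)))) / T n) \<longlongrightarrow> w \<bullet> (u - l)) F"
  proof -
    have "(\<lambda>k. w \<bullet> (X k - Y (Suc k))) \<longlonglongrightarrow> w \<bullet> (- 0)"
      using tendsto_minus[OF gaps_tendsto_zero(2)] by (intro tendsto_inner tendsto_const) simp
    then have "(\<lambda>n. (\<Sum>k\<le>n. lam k * (w \<bullet> (X k - Y (Suc k)))) / T n) \<longlonglongrightarrow> 0"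
      unfolding T_def using lam by (intro weighted_cesaro) simp_all
    from tendsto_mono[OF F(2) this] have "((\<lambda>n. w \<bullet> u - avg n \<bullet> w + (\<Sum>k\<le>n. lam k * (w \<bullet> (X k - Y (Suc k)))) / T n)
        \<longlongrightarrow> w \<bullet> u - l \<bullet> w + 0) F"
      using lim[OF w] by (intro tendsto_add tendsto_diff tendsto_const)
    moreover have "(\<Sum>k\<le>n. lam k * (w \<bullet> (u - Y (Suc k)))) / T n
        = w \<bullet> u - avg n \<bullet> w + (\<Sum>k\<le>n. lam k * (w \<bullet> (X k - Y (Suc k)))) / T n" for n
    proof -
      have "(\<Sum>k\<le>n. lam k * (w \<bullet> (u - Y (Suc k))))
          = T n * (w \<bullet> u) - (\<Sum>k\<le>n. lam k * (X k \<bullet> w)) + (\<Sum>k\<le>n. lam k * (w \<bullet> (X k - Y (Suc k))))"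
        unfolding T_def sum_distrib_right sum_subtractf[symmetric] sum.distrib[symmetric]
        by (intro sum.cong) (simp_all add: inner_diff_right algebra_simps inner_commute[of _ w])
      then show ?thesis
        using weight_sum_pos[of n] by (simp add: avg_inner T_def field_simps)
    qed
    ultimately show ?thesis
      by (simp add: inner_diff_right inner_commute)
  qed
  ultimately show "0 \<le> w \<bullet> (u - l)"
    using F lower by (intro tendsto_le[OF F(1) _ tendsto_mono[OF F(2)]]) (auto elim: filter_leD)
qed

theorem avg_weakly_convergent: "\<exists>l. (l, 0) \<in> S \<and> (\<forall>w\<in>K. (\<lambda>n. avg n \<bullet> w) \<longlonglongrightarrow> l \<bullet> w)"
proof -
  obtain R where R: "\<And>n. norm (avg n) \<le> R"
    using avg_bounded by blast
  have "\<exists>l\<in>{u. (u, 0) \<in> S}. \<forall>w\<in>K. (\<lambda>n. avg n \<bullet> w) \<longlonglongrightarrow> l \<bullet> w"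
  proof (rule opial_convergence[OF K _ R])
    show "l \<in> {u. (u, 0) \<in> S}" if "F \<noteq> bot" "F \<le> sequentially" "l \<in> K"
      "\<And>w. w \<in> K \<Longrightarrow> ((\<lambda>n. avg n \<bullet> w) \<longlongrightarrow> l \<bullet> w) F" for F l
      using cluster_point_is_zero that by blast
    fix a b assume "a \<in> {u. (u, 0) \<in> S}" "b \<in> {u. (u, 0) \<in> S}"
    \<comment> \<open>Polarization: the difference of two squared distances is affine in
      \<open>X n\<close>, so \<open>X n \<bullet> (a - b)\<close> converges, and weighted averaging
      keeps the limit.\<close>
    then have "convergent (\<lambda>n. (norm (X n - b))\<^sup>2 - (norm (X n - a))\<^sup>2)"
      by (intro convergent_diff convergent_norm_diff_zero) auto
    then obtain c where "(\<lambda>n. (norm (X n - b))\<^sup>2 - (norm (X n - a))\<^sup>2) \<longlonglongrightarrow> c"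
      unfolding convergent_def by blast
    then have "(\<lambda>n. ((norm (X n - b))\<^sup>2 - (norm (X n - a))\<^sup>2 + a \<bullet> a - b \<bullet> b) / 2)
        \<longlonglongrightarrow> (c + a \<bullet> a - b \<bullet> b) / 2"
      by (intro tendsto_intros) auto
    moreover have "((norm (X n - b))\<^sup>2 - (norm (X n - a))\<^sup>2 + a \<bullet> a - b \<bullet> b) / 2 = X n \<bullet> (a - b)" for n
      by (simp add: power2_norm_eq_inner inner_simps inner_commute[of a "X n"] inner_commute[of b "X n"])
    ultimately have "(\<lambda>n. X n \<bullet> (a - b)) \<longlonglongrightarrow> (c + a \<bullet> a - b \<bullet> b) / 2"
      by simp
    from weighted_cesaro[OF lam this] show "convergent (\<lambda>n. avg n \<bullet> (a - b))"
      unfolding avg_inner by (rule convergentI)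
  qed (use S in auto)
  then show ?thesis
    by blast
qed

theorem strongly_convergent:
  assumes u: "(u, 0) \<in> S" and \<gamma>: "0 < \<gamma>" and h: "summable h"
    and D: "\<And>n. n \<ge> N \<Longrightarrow>
      (norm (X (Suc n) - u))\<^sup>2 + (norm (X (Suc n) - Y (Suc n)))\<^sup>2
        \<le> (norm (X n - u))\<^sup>2 + (norm (X n - Y n))\<^sup>2
          - 2 * lam n * (\<gamma> * (norm (Y (Suc n) - u))\<^sup>2) + h n"
  shows "X \<longlonglongrightarrow> u"
proof -
  obtain c where c: "(\<lambda>n. (norm (X n - u))\<^sup>2) \<longlonglongrightarrow> c"
    using convergent_norm_diff_zero[OF u] unfolding convergent_def by blast
  then have "(\<lambda>n. norm (X n - u)) \<longlonglongrightarrow> sqrt c"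
    using tendsto_real_sqrt by fastforce
  \<comment> \<open>The surplus controls \<open>Y (Suc n)\<close> while the known limit concerns
    \<open>X n\<close>; the vanishing gap identifies the two limits.\<close>
  moreover have "(\<lambda>n. norm (Y (Suc n) - u) - norm (X n - u)) \<longlonglongrightarrow> 0"
    using tendsto_norm_zero[OF gaps_tendsto_zero(2)]
    by (rule Lim_null_comparison[rotated])
      (auto intro!: always_eventually order_trans[OF norm_triangle_ineq3])
  ultimately have "(\<lambda>n. norm (Y (Suc n) - u)) \<longlonglongrightarrow> sqrt c"
    using tendsto_add by fastforce
  then have lim: "(\<lambda>n. 2 * \<gamma> * (norm (Y (Suc n) - u))\<^sup>2) \<longlonglongrightarrow> 2 * \<gamma> * (sqrt c)\<^sup>2"
    by (intro tendsto_intros)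
  have "summable (\<lambda>n. 2 * lam n * (\<gamma> * (norm (Y (Suc n) - u))\<^sup>2))"
    by (rule quasi_fejer(2)[OF _ _ h, where
          a = "\<lambda>n. (norm (X n - u))\<^sup>2 + (norm (X n - Y n))\<^sup>2" and N = N])
      (use D \<gamma> lam(1) in \<open>auto simp: algebra_simps less_imp_le\<close>)
  then have "summable (\<lambda>n. lam n * (2 * \<gamma> * (norm (Y (Suc n) - u))\<^sup>2))"
    by (simp add: mult_ac)
  from lam this lim have "2 * \<gamma> * (sqrt c)\<^sup>2 = 0"
    by (rule limit_zero_of_summable_weighted) (use \<gamma> in auto)
  with \<gamma> \<open>(\<lambda>n. norm (X n - u)) \<longlonglongrightarrow> sqrt c\<close> have "(\<lambda>n. norm (X n - u)) \<longlonglongrightarrow> 0"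
    by simp
  then show ?thesis
    by (simp add: tendsto_norm_zero_iff LIM_zero_iff)
qed

end

section \<open>Maximality of a Lipschitz perturbation\<close>

text \<open>A solution \<open>u\<close> of \<open>u + t (a + Q u) = l\<close> with \<open>a \<in> T u\<close> is the fixed point of a contraction;
  testing the relation at \<open>u\<close> forces \<open>u = l\<close>.\<close>

lemma zero_of_lipschitz_perturbation:
  fixes T :: "'a::real_inner \<Rightarrow> 'a set"
  assumes K: "subspace K" "complete K"
    and T: "monotone_op T" "Gr T \<subseteq> K \<times> K"
    and range: "\<And>t x. 0 < t \<Longrightarrow> x \<in> K \<Longrightarrow> \<exists>u a. a \<in> T u \<and> u + t *\<^sub>R a = x"
    and Q: "\<And>x. x \<in> K \<Longrightarrow> Q x \<in> K"
      "\<And>x y. x \<in> K \<Longrightarrow> y \<in> K \<Longrightarrow> norm (Q x - Q y) \<le> \<beta> * norm (x - y)"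
    and l: "l \<in> K" and rel: "\<And>u a. a \<in> T u \<Longrightarrow> 0 \<le> (a + Q u) \<bullet> (u - l)"
  shows "- Q l \<in> T l"
proof -
  \<comment> \<open>Chosen so that \<open>t\<close> times \<open>Q\<close> is 1/2-Lipschitz on
    \<open>K\<close>; composing with the nonexpansive \<open>J\<close> keeps the factor 1/2.\<close>
  define t where "t = 1 / (2 * (\<bar>\<beta>\<bar> + 1))"
  have t: "t > 0" "t * \<bar>\<beta>\<bar> \<le> 1 / 2"
    by (auto simp: t_def field_simps)
  obtain J where J: "\<And>x. x \<in> K \<Longrightarrow> \<exists>a. a \<in> T (J x) \<and> J x + t *\<^sub>R a = x"
    using range[OF t(1)] by metis
  have nonexp: "norm (J x - J y) \<le> norm (x - y)" if "x \<in> K" "y \<in> K" for x y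
  proof -
    obtain a b where ab: "a \<in> T (J x)" "J x + t *\<^sub>R a = x" "b \<in> T (J y)" "J y + t *\<^sub>R b = y"
      using J \<open>x \<in> K\<close> \<open>y \<in> K\<close> by metis
    have "x - y = (J x - J y) + t *\<^sub>R (a - b)"
      using ab(2,4) by (metis add_diff_add scaleR_right_diff_distrib)
    then have "(J x - J y) \<bullet> (x - y) = (norm (J x - J y))\<^sup>2 + t * ((J x - J y) \<bullet> (a - b))"
      by (simp add: inner_add_right power2_norm_eq_inner)
    moreover have "0 \<le> t * ((J x - J y) \<bullet> (a - b))"
      using monotone_opD[OF T(1) ab(1,3)] t(1) by simp
    ultimately have "(norm (J x - J y))\<^sup>2 \<le> norm (J x - J y) * norm (x - y)"
      using norm_cauchy_schwarz[of "J x - J y" "x - y"] by linarith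
    then show ?thesis
      by (cases "J x = J y") (auto simp: power2_eq_square)
  qed
  define f where "f = (\<lambda>u. J (l - t *\<^sub>R Q u))"
  have arg: "l - t *\<^sub>R Q u \<in> K" if "u \<in> K" for u
    using that l Q(1) K(1) by (simp add: subspace_diff subspace_scale)
  have "\<exists>!u\<in>K. f u = u"
  proof (rule Banach_fix[OF K(2)])
    show "K \<noteq> {}"
      using l by auto
    show "f ` K \<subseteq> K"
      using J arg T(2) unfolding f_def Gr_def by blast
    show "dist (f x) (f y) \<le> (1 / 2) * dist x y" if "x \<in> K" "y \<in> K" for x y
    proof -
      have "dist (f x) (f y) \<le> norm ((l - t *\<^sub>R Q x) - (l - t *\<^sub>R Q y))"
        unfolding f_def dist_norm using arg that by (intro nonexp)
      also have "\<dots> = t * norm (Q x - Q y)"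
        using t(1) by (simp add: norm_minus_commute scaleR_right_diff_distrib[symmetric])
      also have "\<dots> \<le> t * (\<bar>\<beta>\<bar> * norm (x - y))"
        using t(1) by (intro mult_left_mono order_trans[OF Q(2)[OF that]] mult_right_mono) auto
      also have "\<dots> \<le> (1 / 2) * dist x y"
        using mult_right_mono[OF t(2), of "norm (x - y)"] by (simp add: dist_norm mult_ac)
      finally show ?thesis .
    qed
  qed auto
  then obtain u where u: "u \<in> K" "f u = u"
    by blast
  obtain a where a: "a \<in> T u" "u + t *\<^sub>R a = l - t *\<^sub>R Q u"
    using J[OF arg[OF u(1)]] u(2) unfolding f_def by auto
  have *: "u - l = - (t *\<^sub>R (a + Q u))"
    using a(2) by (simp add: algebra_simps)
  then have "t * ((a + Q u) \<bullet> (a + Q u)) \<le> 0"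
    using rel[OF a(1)] by (simp add: inner_minus_right)
  with t(1) have "a + Q u = 0"
    by (metis inner_eq_zero_iff inner_ge_zero mult_le_0_iff order_antisym not_le)
  with * a(1) show ?thesis
    by (simp add: add_eq_0_iff2)
qed

section \<open>Finitely supported sequences in an inner product space\<close>

text \<open>The direct sum \<open>G 1 \<oplus> \<dots> \<oplus> G m\<close> lives in a type that does not depend on \<open>m\<close>.\<close>

typedef (overloaded) 'a fin_seq = "{f :: nat \<Rightarrow> 'a::zero. finite {i. f i \<noteq> 0}}"
  morphisms coord Abs_fin_seq
  by (rule exI[of _ "\<lambda>_. 0"]) simp

setup_lifting type_definition_fin_seq

lemma finite_coord: "finite {i. coord f i \<noteq> 0}"
  using coord by auto

lemma fin_seq_eqI: "(\<And>i. coord f i = coord g i) \<Longrightarrow> f = g"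
  by (simp add: coord_inject[symmetric] ext)

instantiation fin_seq :: (ab_group_add) ab_group_add
begin

lift_definition zero_fin_seq :: "'a fin_seq" is "\<lambda>_. 0"
  by simp

lift_definition plus_fin_seq :: "'a fin_seq \<Rightarrow> 'a fin_seq \<Rightarrow> 'a fin_seq" is "\<lambda>f g i. f i + g i"
  by (erule (1) rev_finite_subset[OF finite_UnI]) auto

lift_definition minus_fin_seq :: "'a fin_seq \<Rightarrow> 'a fin_seq \<Rightarrow> 'a fin_seq" is "\<lambda>f g i. f i - g i"
  by (erule (1) rev_finite_subset[OF finite_UnI]) auto

lift_definition uminus_fin_seq :: "'a fin_seq \<Rightarrow> 'a fin_seq" is "\<lambda>f i. - f i"
  by simp

instance
  by standard (transfer; simp add: fun_eq_iff add.assoc add.commute)+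

end

instantiation fin_seq :: (real_vector) real_vector
begin

lift_definition scaleR_fin_seq :: "real \<Rightarrow> 'a fin_seq \<Rightarrow> 'a fin_seq" is "\<lambda>c f i. c *\<^sub>R f i"
  by (erule rev_finite_subset) auto

instance
  by standard (transfer; simp add: fun_eq_iff scaleR_add_right scaleR_add_left)+

end

lemma coord_simps [simp]:
  "coord 0 i = 0" "coord (f + g) i = coord f i + coord g i" "coord (f - g) i = coord f i - coord g i"
  "coord (- f) i = - coord f i"
  by (transfer; simp)+

lemma coord_scaleR [simp]: "coord (c *\<^sub>R f) i = c *\<^sub>R coord f i"
  by transfer simp

instantiation fin_seq :: (real_inner) real_inner
begin

definition inner_fin_seq :: "'a fin_seq \<Rightarrow> 'a fin_seq \<Rightarrow> real" where
  "inner_fin_seq f g = (\<Sum>i | coord f i \<noteq> 0. coord f i \<bullet> coord g i)"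

definition norm_fin_seq :: "'a fin_seq \<Rightarrow> real" where
  "norm_fin_seq f = sqrt (f \<bullet> f)"

definition dist_fin_seq :: "'a fin_seq \<Rightarrow> 'a fin_seq \<Rightarrow> real" where
  "dist_fin_seq f g = norm (f - g)"

definition sgn_fin_seq :: "'a fin_seq \<Rightarrow> 'a fin_seq" where
  "sgn_fin_seq f = f /\<^sub>R norm f"

definition uniformity_fin_seq :: "('a fin_seq \<times> 'a fin_seq) filter" where
  "uniformity_fin_seq = (INF e\<in>{0<..}. principal {(f, g). dist f g < e})"

definition open_fin_seq :: "'a fin_seq set \<Rightarrow> bool" where
  "open_fin_seq U \<longleftrightarrow> (\<forall>f\<in>U. \<forall>\<^sub>F (f', g) in uniformity. f' = f \<longrightarrow> g \<in> U)"

lemma inner_fin_seq_eq_sum: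
  fixes f g :: "'a fin_seq"
  assumes "finite I" "{i. coord f i \<noteq> 0} \<subseteq> I"
  shows "f \<bullet> g = (\<Sum>i\<in>I. coord f i \<bullet> coord g i)"
  unfolding inner_fin_seq_def using assms by (intro sum.mono_neutral_left) auto

instance
proof
  fix f g h :: "'a fin_seq" and c :: real
  \<comment> \<open>One finite index set containing the supports of all left arguments, so that
    every inner product below is a sum over \<open>I\<close>.\<close>
  define I where "I = {i. coord f i \<noteq> 0} \<union> {i. coord g i \<noteq> 0}"
  have I: "finite I"
    by (simp add: I_def finite_coord)
  have *: "k \<bullet> h = (\<Sum>i\<in>I. coord k i \<bullet> coord h i)" if "k \<in> {f, g, f + g, c *\<^sub>R f}" for k h
    using that I by (intro inner_fin_seq_eq_sum) (auto simp: I_def)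
  show "f \<bullet> g = g \<bullet> f"
    by (simp add: * inner_commute)
  show "(f + g) \<bullet> h = f \<bullet> h + g \<bullet> h"
    by (simp add: * inner_add_left sum.distrib)
  show "c *\<^sub>R f \<bullet> g = c * (f \<bullet> g)"
    by (simp add: * sum_distrib_left)
  show "0 \<le> f \<bullet> f"
    by (simp add: * sum_nonneg)
  show "f \<bullet> f = 0 \<longleftrightarrow> f = 0"
  proof
    assume "f \<bullet> f = 0"
    then have "\<forall>i\<in>{i. coord f i \<noteq> 0}. coord f i \<bullet> coord f i = 0"
      unfolding inner_fin_seq_def by (subst (asm) sum_nonneg_eq_0_iff) (auto simp: finite_coord)
    then show "f = 0"
      by (intro fin_seq_eqI) (auto simp: inner_eq_zero_iff)
  qed (simp add: inner_fin_seq_def)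
qed (simp_all add: norm_fin_seq_def dist_fin_seq_def sgn_fin_seq_def uniformity_fin_seq_def
    open_fin_seq_def)

end

text \<open>The truncation matters: the families of the iteration are unconstrained outside
  \<open>{1..m}\<close>, and those values must not enter the product.\<close>

lift_definition fin_seq :: "nat \<Rightarrow> (nat \<Rightarrow> 'a::zero) \<Rightarrow> 'a fin_seq" is
  "\<lambda>m f i. if i \<in> {1..m} then f i else 0"
  by (rule finite_subset[of _ "{1.._}"]) auto

lemma coord_fin_seq [simp]: "coord (fin_seq m f) i = (if i \<in> {1..m} then f i else 0)"
  by transfer simp

lemma fin_seq_cong: "(\<And>i. i \<in> {1..m} \<Longrightarrow> f i = g i) \<Longrightarrow> fin_seq m f = fin_seq m g"
  by (intro fin_seq_eqI) simp

lemma fin_seq_add: "fin_seq m f + fin_seq m g = fin_seq m (\<lambda>i. f i + g i)"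
  by (intro fin_seq_eqI) simp

lemma fin_seq_diff: "fin_seq m f - fin_seq m g = fin_seq m (\<lambda>i. f i - g i)"
  by (intro fin_seq_eqI) simp

lemma fin_seq_scaleR: "c *\<^sub>R fin_seq m f = fin_seq m (\<lambda>i. c *\<^sub>R f i)"
  by (intro fin_seq_eqI) simp

lemma inner_fin_seq: "fin_seq m f \<bullet> fin_seq m g = (\<Sum>i=1..m. f i \<bullet> g i)"
  by (subst inner_fin_seq_eq_sum[of "{1..m}"]) auto

lemma norm_fin_seq: "(norm (fin_seq m f))\<^sup>2 = (\<Sum>i=1..m. (norm (f i))\<^sup>2)"
  by (simp add: power2_norm_eq_inner inner_fin_seq)

definition direct_sum :: "nat \<Rightarrow> (nat \<Rightarrow> 'a::zero set) \<Rightarrow> 'a fin_seq set" where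
  "direct_sum m G = fin_seq m ` (\<Pi> i\<in>{1..m}. G i)"

lemma fin_seq_in_direct_sum_iff: "fin_seq m f \<in> direct_sum m G \<longleftrightarrow> (\<forall>i\<in>{1..m}. f i \<in> G i)"
proof
  assume "fin_seq m f \<in> direct_sum m G"
  then obtain g where g: "fin_seq m f = fin_seq m g" "\<forall>i\<in>{1..m}. g i \<in> G i"
    by (auto simp: direct_sum_def)
  have "f i = g i" if "i \<in> {1..m}" for i
    using arg_cong[OF g(1), of "\<lambda>h. coord h i"] that by simp
  with g(2) show "\<forall>i\<in>{1..m}. f i \<in> G i"
    by simp
qed (auto simp: direct_sum_def)

lemma direct_sumE:
  assumes "b \<in> direct_sum m G"
  obtains f where "b = fin_seq m f" "\<And>i. i \<in> {1..m} \<Longrightarrow> f i \<in> G i"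
  using assms unfolding direct_sum_def by (elim imageE) (simp add: Pi_iff)

lemma subspace_direct_sum:
  assumes "\<And>i. i \<in> {1..m} \<Longrightarrow> subspace (G i)"
  shows "subspace (direct_sum m G)"
proof (rule subspaceI)
  have "0 = fin_seq m (\<lambda>_. 0)"
    by (intro fin_seq_eqI) simp
  then show "0 \<in> direct_sum m G"
    using assms by (metis fin_seq_in_direct_sum_iff subspace_0)
qed (use assms in \<open>auto elim!: direct_sumE simp: fin_seq_add fin_seq_scaleR
      fin_seq_in_direct_sum_iff subspace_add subspace_scale\<close>)

text \<open>Coordinate distances are dominated by the total distance, and a finite sum of null
  sequences is null. Fixing \<open>m\<close> is essential: limits of vectors with growing supports
  may leave the type.\<close>

lemma complete_direct_sum:
  fixes G :: "nat \<Rightarrow> 'a::real_inner set"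
  assumes "\<And>i. i \<in> {1..m} \<Longrightarrow> complete (G i)"
  shows "complete (direct_sum m G)"
proof (rule completeI)
  fix s :: "nat \<Rightarrow> 'a fin_seq"
  assume s: "\<forall>n. s n \<in> direct_sum m G" "Cauchy s"
  have "\<exists>f. s n = fin_seq m f \<and> (\<forall>i\<in>{1..m}. f i \<in> G i)" for n
    using s(1)[rule_format, of n] by (rule direct_sumE) blast
  then obtain f where f: "\<And>n. s n = fin_seq m (f n)" "\<And>n i. i \<in> {1..m} \<Longrightarrow> f n i \<in> G i"
    by metis
  have "\<exists>l\<in>G i. (\<lambda>n. f n i) \<longlonglongrightarrow> l" if i: "i \<in> {1..m}" for i
  proof -
    have "dist (f n i) (f k i) \<le> dist (s n) (s k)" for n k
    proof -
      have "(norm (f n i - f k i))\<^sup>2 \<le> (norm (fin_seq m (\<lambda>i. f n i - f k i)))\<^sup>2"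
        unfolding norm_fin_seq using i by (intro member_le_sum) auto
      from power2_le_imp_le[OF this norm_ge_zero] show ?thesis
        by (simp add: dist_norm f(1) fin_seq_diff)
    qed
    then have "Cauchy (\<lambda>n. f n i)"
      using s(2) unfolding Cauchy_def by (meson le_less_trans)
    then show ?thesis
      using completeE[OF assms[OF i], of "\<lambda>n. f n i"] f(2)[OF i] by blast
  qed
  then obtain g where g: "\<And>i. i \<in> {1..m} \<Longrightarrow> g i \<in> G i"
    "\<And>i. i \<in> {1..m} \<Longrightarrow> (\<lambda>n. f n i) \<longlonglongrightarrow> g i"
    by metis
  have "(\<lambda>n. \<Sum>i=1..m. (norm (f n i - g i))\<^sup>2) \<longlonglongrightarrow> (\<Sum>i=1..m. 0\<^sup>2)"
    using g(2) by (intro tendsto_sum tendsto_power tendsto_norm_zero) (simp add: LIM_zero)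
  then have "(\<lambda>n. (norm (s n - fin_seq m g))\<^sup>2) \<longlonglongrightarrow> 0"
    by (simp add: f(1) fin_seq_diff norm_fin_seq)
  then have "(\<lambda>n. norm (s n - fin_seq m g)) \<longlonglongrightarrow> 0"
    using tendsto_real_sqrt by fastforce
  then have "s \<longlonglongrightarrow> fin_seq m g"
    by (simp add: tendsto_norm_zero_iff LIM_zero_iff)
  then show "\<exists>l\<in>direct_sum m G. s \<longlonglongrightarrow> l"
    using g(1) by (intro bexI) (auto simp: fin_seq_in_direct_sum_iff)
qed

section \<open>Adjoints, the descent inequality, and the Fitzpatrick gap\<close>

text \<open>The library proves this only between Euclidean spaces; completeness of the domain suffices.\<close>

lemma adjoint_inner:
  fixes L :: "'h::{real_inner, complete_space} \<Rightarrow> 'g::real_inner"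
  assumes L: "bounded_linear L"
  shows "L x \<bullet> y = x \<bullet> adjoint L y"
proof -
  have "\<exists>g. \<forall>x. L x \<bullet> y = x \<bullet> g" for y
  proof -
    have "\<bar>L x \<bullet> y\<bar> \<le> (onorm L * norm y) * norm x" for x
      using Cauchy_Schwarz_ineq2[of "L x" y] mult_right_mono[OF onorm[OF L, of x], of "norm y"]
      by (simp add: mult_ac)
    then obtain l where "\<And>x. L x \<bullet> y = x \<bullet> l"
      using riesz_representation[of UNIV "\<lambda>x. L x \<bullet> y" "onorm L * norm y"]
      by (auto simp: complete_UNIV linear_add[OF bounded_linear.linear[OF L]]
          linear_scale[OF bounded_linear.linear[OF L]] inner_add_left)
    then show ?thesis
      by blast
  qed
  \<comment> \<open>\<open>adjoint\<close> is a \<open>SOME\<close>, so exhibiting one map with this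
    property settles the claim.\<close>
  then have "\<exists>f'. \<forall>x y. L x \<bullet> y = x \<bullet> f' y"
    by metis
  from someI_ex[OF this] show ?thesis
    unfolding adjoint_def by blast
qed

lemma linear_adjoint_of_bounded:
  fixes L :: "'h::{real_inner, complete_space} \<Rightarrow> 'g::real_inner"
  assumes L: "bounded_linear L"
  shows "linear (adjoint L)"
proof (rule linearI)
  show "adjoint L (a + b) = adjoint L a + adjoint L b" for a b
    by (subst vector_eq_ldot[symmetric]) (simp add: adjoint_inner[OF L, symmetric] inner_add_right)
  show "adjoint L (c *\<^sub>R a) = c *\<^sub>R adjoint L a" for c a
    by (subst vector_eq_ldot[symmetric]) (simp add: adjoint_inner[OF L, symmetric])
qed

text \<open>Pairing the sum \<open>g\<close> with itself moves the adjoints back to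
  \<open>L i g\<close>; Cauchy-Schwarz over the index and cancelling one factor
  \<open>norm g\<close> finish. This is the source of the square root in the step condition.\<close>

lemma norm_sum_adjoint_le:
  fixes L :: "nat \<Rightarrow> 'h::{real_inner, complete_space} \<Rightarrow> 'g::real_inner"
  assumes L: "\<And>i. i \<in> I \<Longrightarrow> bounded_linear (L i)"
  shows "norm (\<Sum>i\<in>I. adjoint (L i) (b i))
    \<le> sqrt (\<Sum>i\<in>I. (onorm (L i))\<^sup>2) * sqrt (\<Sum>i\<in>I. (norm (b i))\<^sup>2)"
proof -
  define g where "g = (\<Sum>i\<in>I. adjoint (L i) (b i))"
  have "(norm g)\<^sup>2 = (\<Sum>i\<in>I. L i g \<bullet> b i)"
    unfolding power2_norm_eq_inner by (subst (2) g_def) (simp add: inner_sum_right adjoint_inner L)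
  also have "\<dots> \<le> (\<Sum>i\<in>I. \<bar>onorm (L i) * norm g\<bar> * \<bar>norm (b i)\<bar>)"
  proof (intro sum_mono)
    fix i assume "i \<in> I"
    then show "L i g \<bullet> b i \<le> \<bar>onorm (L i) * norm g\<bar> * \<bar>norm (b i)\<bar>"
      using norm_cauchy_schwarz[of "L i g" "b i"]
        mult_right_mono[OF onorm[OF L, of i g], of "norm (b i)"] onorm_pos_le[OF L, of i]
      by simp
  qed
  also have "\<dots> \<le> sqrt (\<Sum>i\<in>I. (onorm (L i) * norm g)\<^sup>2) * sqrt (\<Sum>i\<in>I. (norm (b i))\<^sup>2)"
    using L2_set_mult_ineq unfolding L2_set_def .
  also have "(\<Sum>i\<in>I. (onorm (L i) * norm g)\<^sup>2) = (\<Sum>i\<in>I. (onorm (L i))\<^sup>2) * (norm g)\<^sup>2"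
    by (simp add: power_mult_distrib sum_distrib_right)
  also have "sqrt \<dots> = sqrt (\<Sum>i\<in>I. (onorm (L i))\<^sup>2) * norm g"
    by (simp add: real_sqrt_mult)
  finally have "norm g * norm g
      \<le> norm g * (sqrt (\<Sum>i\<in>I. (onorm (L i))\<^sup>2) * sqrt (\<Sum>i\<in>I. (norm (b i))\<^sup>2))"
    unfolding power2_eq_square[of "norm g"] by (simp only: mult_ac)
  then show ?thesis
    unfolding g_def[symmetric]
    by (cases "g = 0") (auto intro!: mult_nonneg_nonneg real_sqrt_ge_zero sum_nonneg)
qed

text \<open>Expand \<open>\<parallel>X' - u\<parallel>\<^sup>2\<close> around \<open>Y'\<close>, use
  \<open>\<parallel>Y' - Y\<parallel>\<^sup>2 \<le> 2 \<parallel>Y' - X\<parallel>\<^sup>2 + 2 \<parallel>X - Y\<parallel>\<^sup>2\<close>, and spend \<open>2 c\<^sup>2 \<parallel>Y' - Y\<parallel>\<^sup>2\<close> on two copies of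
  \<open>\<parallel>X' - Y'\<parallel>\<^sup>2\<close>.\<close>

lemma forward_backward_descent:
  fixes X X' Y Y' u g :: "'a::real_inner"
  assumes X': "X' = X - t *\<^sub>R g" and le: "norm (X' - Y') \<le> c * norm (Y' - Y)" and c: "0 \<le> c"
  shows "(norm (X' - u))\<^sup>2 + (norm (X' - Y'))\<^sup>2
    \<le> (norm (X - u))\<^sup>2 + (norm (X - Y))\<^sup>2 - 2 * t * (g \<bullet> (Y' - u)) - (1/2 - 2 * c\<^sup>2) * (norm (Y' - Y))\<^sup>2"
proof -
  have "(norm (X' - u))\<^sup>2 = (norm (X - u))\<^sup>2 + 2 * ((X' - X) \<bullet> (Y' - u)) + (norm (X' - Y'))\<^sup>2
      - (norm (X - Y'))\<^sup>2"
    unfolding power2_norm_eq_inner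
    by (simp add: inner_simps inner_commute[of X' X] inner_commute[of X' Y'] inner_commute[of X Y']
        inner_commute[of X' u] inner_commute[of X u] inner_commute[of Y' u] algebra_simps)
  moreover have "(X' - X) \<bullet> (Y' - u) = - t * (g \<bullet> (Y' - u))"
    by (simp add: X')
  moreover have "(norm (X' - Y'))\<^sup>2 \<le> c\<^sup>2 * (norm (Y' - Y))\<^sup>2"
    using power_mono[OF le norm_ge_zero, of 2] by (simp add: power_mult_distrib)
  moreover have "(norm (Y' - Y))\<^sup>2 \<le> 2 * (norm (X - Y'))\<^sup>2 + 2 * (norm (X - Y))\<^sup>2"
  proof -
    have "0 \<le> (norm ((X - Y') + (X - Y)))\<^sup>2"
      by simp
    then show ?thesis
      unfolding power2_norm_eq_inner
      by (simp add: inner_simps inner_commute[of Y' X] inner_commute[of Y X] inner_commute[of Y' Y]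
          algebra_simps)
  qed
  ultimately show ?thesis
    by (simp add: algebra_simps)
qed

text \<open>Since \<open>p\<close> is normal at \<open>u\<close>, the supremum in
  \<open>support_fun\<close> is attained at \<open>u\<close>, and each \<open>y\<close> offers
  \<open>(y, B y)\<close> as a candidate in the Fitzpatrick function at \<open>u\<close>. The terms
  of the series thus bound the penalization mismatch uniformly in \<open>y\<close>.\<close>

lemma fitzpatrick_gap_summable:
  fixes B :: "'h::real_inner \<Rightarrow> 'h"
  assumes C: "C = zer (\<lambda>w. {B w})" and p: "p \<in> normal_cone C u"
    and pos: "\<And>n. lam n > 0" "\<And>n. \<beta> n > 0"
    and fin: "(\<Sum>n. ereal (lam n * \<beta> n) *
      ((SUP u\<in>C. fitzpatrick (\<lambda>w. {B w}) u (p /\<^sub>R \<beta> n)) - support_fun C (p /\<^sub>R \<beta> n))) < \<infinity>"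
  shows "\<exists>h. summable h \<and> (\<forall>n y. lam n * (\<beta> n * (B y \<bullet> (u - y)) + p \<bullet> (y - u)) \<le> h n)"
proof -
  have u: "u \<in> C" "\<And>y. y \<in> C \<Longrightarrow> (y - u) \<bullet> p \<le> 0"
    using p by (auto simp: normal_cone_def split: if_splits)
  define f where "f = (\<lambda>n. (SUP u\<in>C. fitzpatrick (\<lambda>w. {B w}) u (p /\<^sub>R \<beta> n)))"
  define \<sigma> where "\<sigma> = (\<lambda>n. u \<bullet> (p /\<^sub>R \<beta> n))"
  have supp: "support_fun C (p /\<^sub>R \<beta> n) = ereal (\<sigma> n)" for n
    unfolding support_fun_def
  proof (intro antisym SUP_least)
    fix y assume "y \<in> C"
    then show "ereal (y \<bullet> (p /\<^sub>R \<beta> n)) \<le> ereal (\<sigma> n)"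
      using u(2)[of y] pos(2)[of n] by (simp add: \<sigma>_def inner_diff_left)
  qed (unfold \<sigma>_def, intro SUP_upper u(1))
  have f_lower: "ereal (u \<bullet> B y + y \<bullet> (p /\<^sub>R \<beta> n) - y \<bullet> B y) \<le> f n" for y n
  proof -
    have "ereal (u \<bullet> B y + y \<bullet> (p /\<^sub>R \<beta> n) - y \<bullet> B y) \<le> fitzpatrick (\<lambda>w. {B w}) u (p /\<^sub>R \<beta> n)"
      unfolding fitzpatrick_def by (rule SUP_upper2[of "(y, B y)"]) (auto simp: Gr_def)
    also have "\<dots> \<le> f n"
      unfolding f_def using u(1) by (rule SUP_upper)
    finally show ?thesis .
  qed
  \<comment> \<open>The graph pair \<open>(u, 0)\<close> makes every bracket nonnegative, so
    finiteness of the series makes each term finite and \<open>real_of_ereal\<close> loses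
    nothing.\<close>
  have "B u = 0"
    using u(1) C by (auto simp: zer_def)
  then have f_ge: "ereal (\<sigma> n) \<le> f n" for n
    using f_lower[of u n] by (simp add: \<sigma>_def)
  define e where "e = (\<lambda>n. ereal (lam n * \<beta> n) * (f n - ereal (\<sigma> n)))"
  have e_nonneg: "0 \<le> e n" for n
    unfolding e_def using pos[of n] f_ge[of n]
    by (intro ereal_0_le_mult) (auto simp: less_imp_le ereal_diff_positive)
  have fin': "(\<Sum>n. e n) \<noteq> \<infinity>"
    using fin by (simp add: e_def f_def supp)
  have "lam n * (\<beta> n * (B y \<bullet> (u - y)) + p \<bullet> (y - u)) \<le> real_of_ereal (e n)" for n y
  proof -
    have "e n \<noteq> \<infinity>"
      using suminf_PInfty[OF e_nonneg fin'] .
    then have "f n \<noteq> \<infinity>"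
      using pos[of n] by (auto simp: e_def)
    then obtain r where r: "f n = ereal r"
      using f_ge[of n] by (cases "f n") auto
    have "u \<bullet> B y + y \<bullet> (p /\<^sub>R \<beta> n) - y \<bullet> B y - \<sigma> n \<le> r - \<sigma> n"
      using f_lower[of y n] by (simp add: r)
    then have "lam n * \<beta> n * (u \<bullet> B y + y \<bullet> (p /\<^sub>R \<beta> n) - y \<bullet> B y - \<sigma> n) \<le> lam n * \<beta> n * (r - \<sigma> n)"
      using pos[of n] by (intro mult_left_mono) auto
    moreover have "lam n * \<beta> n * (u \<bullet> B y + y \<bullet> (p /\<^sub>R \<beta> n) - y \<bullet> B y - \<sigma> n)
        = lam n * (\<beta> n * (B y \<bullet> (u - y)) + p \<bullet> (y - u))"
      using pos(2)[of n]
      by (simp add: \<sigma>_def inner_diff_right inner_commute[of "B y"] inner_commute[of p] field_simps)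
    ultimately have "lam n * (\<beta> n * (B y \<bullet> (u - y)) + p \<bullet> (y - u)) \<le> lam n * \<beta> n * (r - \<sigma> n)"
      by (simp only:)
    then show ?thesis
      by (simp add: e_def r)
  qed
  moreover have "summable (\<lambda>n. real_of_ereal (e n))"
    using e_nonneg fin' by (rule summable_real_of_ereal)
  ultimately show ?thesis
    by (intro exI[of _ "\<lambda>n. real_of_ereal (e n)"]) blast
qed

section \<open>The primal-dual iteration as a scheme in the product space\<close>

text \<open>Two hypotheses enter in processed form: the Fitzpatrick series as the summable bound
  \<open>gap\<close>, and the limsup condition as a bound \<open>c0\<close> valid from
  \<open>N\<close> on.\<close>

locale primal_dual =
  fixes A :: "'h::{real_inner, complete_space} \<Rightarrow> 'h set"
    and D B :: "'h \<Rightarrow> 'h"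
    and m :: nat
    and G :: "nat \<Rightarrow> 'g::real_inner set"
    and Bs :: "nat \<Rightarrow> 'g \<Rightarrow> 'g set"
    and L :: "nat \<Rightarrow> 'h \<Rightarrow> 'g"
    and \<nu> \<mu> :: real
    and C Z :: "'h set"
    and lam \<beta> :: "nat \<Rightarrow> real"
    and x :: "nat \<Rightarrow> 'h"
    and y :: "int \<Rightarrow> 'h"
    and v :: "nat \<Rightarrow> nat \<Rightarrow> 'g"
    and q :: "nat \<Rightarrow> int \<Rightarrow> 'g"
    and c0 :: real and N :: nat
  assumes A: "maximally_monotone A"
    and D: "monotone_op (\<lambda>w. {D w})" "\<nu>-lipschitz_on UNIV D"
    and G: "\<And>i. i \<in> {1..m} \<Longrightarrow> subspace (G i)" "\<And>i. i \<in> {1..m} \<Longrightarrow> complete (G i)"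
    and Bs: "\<And>i. i \<in> {1..m} \<Longrightarrow> maximally_monotone_on (G i) (Bs i)"
    and L: "\<And>i. i \<in> {1..m} \<Longrightarrow> bounded_linear (L i)" "\<And>i w. i \<in> {1..m} \<Longrightarrow> L i w \<in> G i"
    and B: "\<mu> > 0" "(inverse \<mu>)-lipschitz_on UNIV B"
    and Z: "Z = zer (\<lambda>w. A w + (\<Sum>i=1..m. adjoint (L i) ` Bs i (L i w)) + {D w} + normal_cone C w)"
    and Z_nonempty: "Z \<noteq> {}"
    and lam: "\<And>n. lam n > 0" "\<not> summable lam" and \<beta>: "\<And>n. \<beta> n > 0"
    and init: "\<And>i. i \<in> {1..m} \<Longrightarrow> v i 0 \<in> G i"
      "\<And>i. i \<in> {1..m} \<Longrightarrow> q i (-1) = v i 0"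
    and y: "\<And>n. y (int n) = resolvent (scale_op (lam n) A)
        (x n - lam n *\<^sub>R (D (y (int n - 1)) + (\<Sum>i=1..m. adjoint (L i) (q i (int n - 1))))
             - (lam n * \<beta> n) *\<^sub>R B (y (int n - 1)))"
    and q: "\<And>i n. i \<in> {1..m} \<Longrightarrow>
        q i (int n) = resolvent (scale_op (lam n) (inv_op (Bs i)))
          (v i n + lam n *\<^sub>R L i (y (int n - 1)))"
    and x: "\<And>n. x (Suc n) =
        (lam n * \<beta> n) *\<^sub>R (B (y (int n - 1)) - B (y (int n)))
        + lam n *\<^sub>R (D (y (int n - 1)) - D (y (int n)))
        + lam n *\<^sub>R (\<Sum>i=1..m. adjoint (L i) (q i (int n - 1) - q i (int n)))
        + y (int n)"
    and v: "\<And>i n. i \<in> {1..m} \<Longrightarrow>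
        v i (Suc n) = lam n *\<^sub>R L i (y (int n) - y (int n - 1)) + q i (int n)"
    and A_normal: "maximally_monotone (\<lambda>w. A w + normal_cone C w)"
    and gap: "\<And>u p. p \<in> normal_cone C u \<Longrightarrow> \<exists>h. summable h \<and>
        (\<forall>n y. lam n * (\<beta> n * (B y \<bullet> (u - y)) + p \<bullet> (y - u)) \<le> h n)"
    and c0: "c0 < 1 / 2" "\<And>n. n \<ge> N \<Longrightarrow> lam n * \<beta> n / \<mu>
        + lam n * (\<nu> + sqrt (\<Sum>i=1..m. (onorm (L i))\<^sup>2)) \<le> c0"
begin

section \<open>Splitting the inclusion in the product space\<close>

definition K :: "('h \<times> 'g fin_seq) set" where
  "K = UNIV \<times> direct_sum m G"

definition T :: "'h \<times> 'g fin_seq \<Rightarrow> ('h \<times> 'g fin_seq) set" where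
  "T p = {(a, fin_seq m c) | a c b. snd p = fin_seq m b \<and> a \<in> A (fst p) + normal_cone C (fst p) \<and>
     (\<forall>i\<in>{1..m}. b i \<in> Bs i (c i))}"

definition Q :: "'h \<times> 'g fin_seq \<Rightarrow> 'h \<times> 'g fin_seq" where
  "Q p = (D (fst p) + (\<Sum>i=1..m. adjoint (L i) (coord (snd p) i)), fin_seq m (\<lambda>i. - L i (fst p)))"

definition S :: "(('h \<times> 'g fin_seq) \<times> ('h \<times> 'g fin_seq)) set" where
  "S = {(u, a + Q u) | u a. a \<in> T u}"

definition X :: "nat \<Rightarrow> 'h \<times> 'g fin_seq" where
  "X n = (x n, fin_seq m (\<lambda>i. v i n))"

definition Y :: "nat \<Rightarrow> 'h \<times> 'g fin_seq" where
  "Y n = (y (int n - 1), fin_seq m (\<lambda>i. q i (int n - 1)))"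

lemma T_iff: "(a, fin_seq m c) \<in> T (w, fin_seq m b) \<longleftrightarrow>
  a \<in> A w + normal_cone C w \<and> (\<forall>i\<in>{1..m}. b i \<in> Bs i (c i))"
proof
  assume "(a, fin_seq m c) \<in> T (w, fin_seq m b)"
  then obtain c' b' where *: "fin_seq m c = fin_seq m c'" "fin_seq m b = fin_seq m b'"
    "a \<in> A w + normal_cone C w" "\<forall>i\<in>{1..m}. b' i \<in> Bs i (c' i)"
    by (auto simp: T_def)
  have "c i = c' i \<and> b i = b' i" if "i \<in> {1..m}" for i
    using arg_cong[OF *(1), of "\<lambda>h. coord h i"] arg_cong[OF *(2), of "\<lambda>h. coord h i"] that by simp
  with * show "a \<in> A w + normal_cone C w \<and> (\<forall>i\<in>{1..m}. b i \<in> Bs i (c i))"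
    by metis
qed (auto simp: T_def)

lemma T_cases:
  assumes "p \<in> T u"
  shows "\<exists>w b a c. u = (w, fin_seq m b) \<and> p = (a, fin_seq m c) \<and>
    a \<in> A w + normal_cone C w \<and> (\<forall>i\<in>{1..m}. b i \<in> Bs i (c i))"
proof -
  obtain a c b where *: "p = (a, fin_seq m c)" "snd u = fin_seq m b"
    "a \<in> A (fst u) + normal_cone C (fst u)" "\<forall>i\<in>{1..m}. b i \<in> Bs i (c i)"
    using assms unfolding T_def by blast
  then have "u = (fst u, fin_seq m b)"
    by (metis prod.collapse)
  with * show ?thesis
    by blast
qed

lemma Bs_carrier:
  assumes "i \<in> {1..m}" "b \<in> Bs i c"
  shows "b \<in> G i" "c \<in> G i"
  using Bs[OF assms(1)] assms(2) by (auto simp: maximally_monotone_on_def Gr_def)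

lemma K: "subspace K" "complete K"
  unfolding K_def using G
  by (auto intro!: subspace_Times subspace_direct_sum complete_Times_set complete_direct_sum
      complete_UNIV simp del: One_nat_def)

lemma T_in_K: "Gr T \<subseteq> K \<times> K"
proof -
  have "u \<in> K \<and> p \<in> K" if pu: "p \<in> T u" for u p
  proof -
    obtain w b a c where *: "u = (w, fin_seq m b)" "p = (a, fin_seq m c)"
      "\<forall>i\<in>{1..m}. b i \<in> Bs i (c i)"
      using T_cases[OF pu] by blast
    have "\<forall>i\<in>{1..m}. b i \<in> G i" "\<forall>i\<in>{1..m}. c i \<in> G i"
      using *(3) Bs_carrier by blast+
    then show ?thesis
      unfolding * K_def by (simp add: fin_seq_in_direct_sum_iff del: One_nat_def)
  qed
  then show ?thesis
    by (auto simp: Gr_def)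
qed

lemma monotone_T: "monotone_op T"
proof -
  have "0 \<le> (u - u') \<bullet> (p - p')" if p: "p \<in> T u" "p' \<in> T u'" for u p u' p'
  proof -
    obtain w b a c where 1: "u = (w, fin_seq m b)" "p = (a, fin_seq m c)"
      "a \<in> A w + normal_cone C w" "\<And>i. i \<in> {1..m} \<Longrightarrow> b i \<in> Bs i (c i)"
      using T_cases[OF p(1)] by blast
    obtain w' b' a' c' where 2: "u' = (w', fin_seq m b')" "p' = (a', fin_seq m c')"
      "a' \<in> A w' + normal_cone C w'" "\<And>i. i \<in> {1..m} \<Longrightarrow> b' i \<in> Bs i (c' i)"
      using T_cases[OF p(2)] by blast
    have "0 \<le> (w - w') \<bullet> (a - a')"
      using A_normal 1(3) 2(3) unfolding maximally_monotone_on_def by (blast intro: monotone_opD)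
    moreover have "0 \<le> (\<Sum>i=1..m. (b i - b' i) \<bullet> (c i - c' i))"
    proof (intro sum_nonneg)
      fix i assume i: "i \<in> {1..m}"
      have "0 \<le> (c i - c' i) \<bullet> (b i - b' i)"
        using Bs[OF i] 1(4)[OF i] 2(4)[OF i] unfolding maximally_monotone_on_def
        by (blast intro: monotone_opD)
      then show "0 \<le> (b i - b' i) \<bullet> (c i - c' i)"
        by (simp add: inner_commute)
    qed
    ultimately show ?thesis
      by (simp add: 1(1,2) 2(1,2) fin_seq_diff inner_fin_seq)
  qed
  then show ?thesis
    by (auto simp: monotone_op_def Gr_def)
qed

text \<open>The equation decouples into one for \<open>A w + normal_cone C w\<close> and one for
  each inverse of \<open>Bs i\<close> on \<open>G i\<close>. Here maximality of the first operator,
  not merely its monotonicity, is used.\<close>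

lemma T_range:
  assumes t: "0 < t" and p: "p \<in> K"
  shows "\<exists>u a. a \<in> T u \<and> u + t *\<^sub>R a = p"
proof -
  obtain w f where wf: "p = (w, fin_seq m f)" "\<And>i. i \<in> {1..m} \<Longrightarrow> f i \<in> G i"
    using p unfolding K_def by (auto elim: direct_sumE)
  obtain u a where ua: "a \<in> A u + normal_cone C u" "u + t *\<^sub>R a = w"
    using minty_surjective[OF subspace_UNIV complete_UNIV A_normal t, of w] by blast
  have "\<exists>b c. b \<in> Bs i c \<and> b + t *\<^sub>R c = f i" if i: "i \<in> {1..m}" for i
    using minty_surjective[OF G[OF i] maximally_monotone_on_inv_op[OF Bs[OF i]] t wf(2)[OF i]]
    unfolding inv_op_def by blast
  then obtain b c where bc: "\<And>i. i \<in> {1..m} \<Longrightarrow> b i \<in> Bs i (c i)"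
    "\<And>i. i \<in> {1..m} \<Longrightarrow> b i + t *\<^sub>R c i = f i"
    by metis
  have "fin_seq m b + t *\<^sub>R fin_seq m c = fin_seq m f"
    unfolding fin_seq_scaleR fin_seq_add using bc(2) by (intro fin_seq_cong)
  then show ?thesis
    using ua bc(1) T_iff[of a c u b] by (intro exI[of _ "(u, fin_seq m b)"] exI[of _ "(a, fin_seq m c)"])
      (auto simp: wf(1))
qed

lemma Q_in_K: "Q p \<in> K"
  by (auto simp: Q_def K_def fin_seq_in_direct_sum_iff subspace_neg[OF G(1)] L(2) simp del: One_nat_def)

lemma Q_diff: "Q (w, fin_seq m b) - Q (w', fin_seq m b') = (D w - D w', 0) +
  (\<Sum>i=1..m. adjoint (L i) (b i - b' i), fin_seq m (\<lambda>i. - L i (w - w')))"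
proof -
  have "(\<Sum>i=1..m. adjoint (L i) (b i)) - (\<Sum>i=1..m. adjoint (L i) (b' i))
      = (\<Sum>i=1..m. adjoint (L i) (b i - b' i))"
    unfolding sum_subtractf[symmetric]
    by (intro sum.cong refl) (simp add: linear_diff[OF linear_adjoint_of_bounded[OF L(1)]] del: One_nat_def)
  moreover have "fin_seq m (\<lambda>i. - L i w) - fin_seq m (\<lambda>i. - L i w') = fin_seq m (\<lambda>i. - L i (w - w'))"
    unfolding fin_seq_diff
    by (intro fin_seq_cong) (simp add: linear_diff[OF bounded_linear.linear[OF L(1)]] del: One_nat_def)
  moreover have "(\<Sum>i=1..m. adjoint (L i) (coord (fin_seq m b) i)) = (\<Sum>i=1..m. adjoint (L i) (b i))" for b
    by (intro sum.cong) auto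
  ultimately show ?thesis
    by (simp add: Q_def algebra_simps)
qed

lemma KE:
  assumes "p \<in> K"
  obtains w b where "p = (w, fin_seq m b)" "\<And>i. i \<in> {1..m} \<Longrightarrow> b i \<in> G i"
  using assms unfolding K_def by (auto elim: direct_sumE)

text \<open>The coupling is skew: the adjoint terms cancel against those with \<open>- L i\<close>,
  leaving the contribution of \<open>D\<close>.\<close>

lemma monotone_Q:
  assumes "p \<in> K" "p' \<in> K"
  shows "0 \<le> (Q p - Q p') \<bullet> (p - p')"
proof -
  obtain w b w' b' where p: "p = (w, fin_seq m b)" "p' = (w', fin_seq m b')"
    using assms by (auto elim!: KE)
  have "0 \<le> (w - w') \<bullet> (D w - D w')"
    using monotone_opD[OF D(1), of "D w" w "D w'" w'] by simp
  moreover have "(\<Sum>i=1..m. adjoint (L i) (b i - b' i)) \<bullet> (w - w')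
      = (\<Sum>i=1..m. L i (w - w') \<bullet> (b i - b' i))"
    unfolding inner_sum_left
    by (intro sum.cong refl) (metis L(1) adjoint_inner inner_commute)
  ultimately show ?thesis
    unfolding p Q_diff
    by (simp add: fin_seq_diff inner_fin_seq inner_add_left sum_negf inner_commute[of "w - w'"] p)
qed

text \<open>The coupling exchanges the two components, each with norm bound \<open>l\<close>, so by
  Pythagoras its constant is \<open>l\<close> and not \<open>2 * l\<close>; \<open>D\<close> adds
  \<open>\<nu>\<close>.\<close>

lemma lipschitz_Q:
  assumes "p \<in> K" "p' \<in> K"
  shows "norm (Q p - Q p') \<le> (\<nu> + sqrt (\<Sum>i=1..m. (onorm (L i))\<^sup>2)) * norm (p - p')"
proof -
  obtain w b w' b' where p: "p = (w, fin_seq m b)" "p' = (w', fin_seq m b')"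
    using assms by (auto elim!: KE)
  define l where "l = sqrt (\<Sum>i=1..m. (onorm (L i))\<^sup>2)"
  have l: "0 \<le> l" "l\<^sup>2 = (\<Sum>i=1..m. (onorm (L i))\<^sup>2)"
    by (simp_all add: l_def sum_nonneg)
  have norm_pp: "(norm (p - p'))\<^sup>2 = (norm (w - w'))\<^sup>2 + (\<Sum>i=1..m. (norm (b i - b' i))\<^sup>2)"
    by (simp add: p norm_Pair fin_seq_diff norm_fin_seq sum_nonneg)
  have "norm (D w - D w') \<le> \<nu> * norm (w - w')"
    using lipschitz_onD[OF D(2), of w w'] by (simp add: dist_norm)
  also have "\<dots> \<le> \<nu> * norm (p - p')"
  proof (rule mult_left_mono[OF power2_le_imp_le])
    show "(norm (w - w'))\<^sup>2 \<le> (norm (p - p'))\<^sup>2"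
      by (simp add: norm_pp sum_nonneg)
  qed (use lipschitz_on_nonneg[OF D(2)] in auto)
  finally have 1: "norm (D w - D w', 0 :: 'g fin_seq) \<le> \<nu> * norm (p - p')"
    by (simp add: norm_Pair)
  have "(norm (\<Sum>i=1..m. adjoint (L i) (b i - b' i)))\<^sup>2 \<le> l\<^sup>2 * (\<Sum>i=1..m. (norm (b i - b' i))\<^sup>2)"
  proof -
    have "norm (\<Sum>i=1..m. adjoint (L i) (b i - b' i)) \<le> l * sqrt (\<Sum>i=1..m. (norm (b i - b' i))\<^sup>2)"
      unfolding l_def using L(1) by (rule norm_sum_adjoint_le)
    from power_mono[OF this norm_ge_zero, of 2] show ?thesis
      by (simp add: power_mult_distrib sum_nonneg)
  qed
  moreover have "(\<Sum>i=1..m. (norm (L i (w - w')))\<^sup>2) \<le> l\<^sup>2 * (norm (w - w'))\<^sup>2"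
  proof -
    have "(norm (L i (w - w')))\<^sup>2 \<le> (onorm (L i))\<^sup>2 * (norm (w - w'))\<^sup>2" if "i \<in> {1..m}" for i
      using power_mono[OF onorm[OF L(1)[OF that]] norm_ge_zero, of "w - w'" 2]
      by (simp add: power_mult_distrib)
    then show ?thesis
      unfolding l(2) sum_distrib_right by (intro sum_mono)
  qed
  ultimately have "(norm (\<Sum>i=1..m. adjoint (L i) (b i - b' i), fin_seq m (\<lambda>i. - L i (w - w'))))\<^sup>2
      \<le> (l * norm (p - p'))\<^sup>2"
    unfolding power_mult_distrib norm_pp
    by (simp add: norm_Pair norm_fin_seq sum_nonneg algebra_simps)
  then have "norm (\<Sum>i=1..m. adjoint (L i) (b i - b' i), fin_seq m (\<lambda>i. - L i (w - w')))
      \<le> l * norm (p - p')"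
    using power2_le_imp_le l(1) by simp
  then have "norm (Q p - Q p') \<le> \<nu> * norm (p - p') + l * norm (p - p')"
    unfolding p Q_diff using 1 by (intro norm_triangle_mono) (simp_all add: p)
  then show ?thesis
    by (simp add: l_def algebra_simps)
qed

section \<open>One step of the iteration in the product space\<close>

lemma q_step:
  assumes i: "i \<in> {1..m}" and vG: "v i n \<in> G i"
  shows "q i (int n) \<in> G i"
    "\<exists>c. q i (int n) \<in> Bs i c \<and> q i (int n) + lam n *\<^sub>R c = v i n + lam n *\<^sub>R L i (y (int n - 1))"
proof -
  have "v i n + lam n *\<^sub>R L i (y (int n - 1)) \<in> G i"
    using G(1)[OF i] vG L(2)[OF i] by (simp add: subspace_add subspace_scale)
  from resolvent_scale_op[OF G[OF i] maximally_monotone_on_inv_op[OF Bs[OF i]] lam(1)[of n] this]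
  show "q i (int n) \<in> G i"
    "\<exists>c. q i (int n) \<in> Bs i c \<and> q i (int n) + lam n *\<^sub>R c = v i n + lam n *\<^sub>R L i (y (int n - 1))"
    unfolding q[OF i] inv_op_def by blast+
qed

text \<open>\<open>resolvent\<close> is controlled only at arguments in \<open>G i\<close>, so
  membership has to be carried along the iteration.\<close>

lemma v_in_G: "i \<in> {1..m} \<Longrightarrow> v i n \<in> G i"
proof (induction n)
  case (Suc n)
  then show ?case
    unfolding v[OF Suc.prems] using q_step(1) G(1) L(2) by (intro subspace_add subspace_scale) auto
qed (use init in auto)

lemma Y_in_K: "Y n \<in> K"
proof -
  have "q i (int n - 1) \<in> G i" if i: "i \<in> {1..m}" for i
  \<comment> \<open>For \<open>n = 0\<close> the index is -1, where the initial condition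
    \<open>q i (-1) = v i 0\<close> applies.\<close>
  proof (cases n)
    case (Suc k)
    then show ?thesis
      using q_step(1)[OF i v_in_G[OF i], of k] by simp
  qed (use init i in auto)
  then show ?thesis
    by (simp add: Y_def K_def fin_seq_in_direct_sum_iff)
qed

lemma Y_Suc: "Y (Suc n) = (y (int n), fin_seq m (\<lambda>i. q i (int n)))"
  by (simp add: Y_def)

text \<open>The resolvent identity cancels all forward terms at the previous point: the update is an
  explicit step from \<open>X n\<close> along a vector evaluated at \<open>Y (Suc n)\<close>. It
  contains \<open>\<beta> n *\<^sub>R B (y (int n))\<close> where the target operator has a normal
  vector.\<close>

lemma product_step:
  "\<exists>\<alpha> c. \<alpha> \<in> A (y (int n)) \<and> (\<forall>i\<in>{1..m}. q i (int n) \<in> Bs i (c i)) \<and>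
     X (Suc n) = X n - lam n *\<^sub>R ((\<alpha>, fin_seq m c) + Q (Y (Suc n)) + (\<beta> n *\<^sub>R B (y (int n)), 0))"
proof -
  define f where "f = x n - lam n *\<^sub>R (D (y (int n - 1)) + (\<Sum>i=1..m. adjoint (L i) (q i (int n - 1))))
             - (lam n * \<beta> n) *\<^sub>R B (y (int n - 1))"
  obtain \<alpha> where \<alpha>: "\<alpha> \<in> A (y (int n))" "y (int n) + lam n *\<^sub>R \<alpha> = f"
    using resolvent_scale_op[OF subspace_UNIV complete_UNIV A lam(1)[of n], of f]
    unfolding y f_def by blast
  have "\<exists>c. q i (int n) \<in> Bs i c \<and> q i (int n) + lam n *\<^sub>R c = v i n + lam n *\<^sub>R L i (y (int n - 1))"
    if "i \<in> {1..m}" for i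
    using q_step(2)[OF that v_in_G[OF that]] .
  then obtain c where c: "\<And>i. i \<in> {1..m} \<Longrightarrow> q i (int n) \<in> Bs i (c i)"
    "\<And>i. i \<in> {1..m} \<Longrightarrow> q i (int n) + lam n *\<^sub>R c i = v i n + lam n *\<^sub>R L i (y (int n - 1))"
    by metis
  have sum_eq: "(\<Sum>i=1..m. adjoint (L i) (q i (int n - 1) - q i (int n)))
      = (\<Sum>i=1..m. adjoint (L i) (q i (int n - 1))) - (\<Sum>i=1..m. adjoint (L i) (q i (int n)))"
    unfolding sum_subtractf[symmetric]
    by (intro sum.cong refl) (simp add: linear_diff[OF linear_adjoint_of_bounded[OF L(1)]] del: One_nat_def)
  have x_eq: "x n = y (int n) + lam n *\<^sub>R \<alpha>
      + lam n *\<^sub>R (D (y (int n - 1)) + (\<Sum>i=1..m. adjoint (L i) (q i (int n - 1))))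
      + (lam n * \<beta> n) *\<^sub>R B (y (int n - 1))"
    using \<alpha>(2) unfolding f_def by (simp del: One_nat_def)
  have "x (Suc n) = x n - lam n *\<^sub>R (\<alpha> + D (y (int n))
      + (\<Sum>i=1..m. adjoint (L i) (q i (int n))) + \<beta> n *\<^sub>R B (y (int n)))"
    unfolding x[of n] sum_eq x_eq by (simp add: algebra_simps)
  moreover have "v i (Suc n) = v i n - lam n *\<^sub>R (c i - L i (y (int n)))" if i: "i \<in> {1..m}" for i
  proof -
    have "q i (int n) = v i n + lam n *\<^sub>R L i (y (int n - 1)) - lam n *\<^sub>R c i"
      using c(2)[OF i] by (simp add: eq_diff_eq)
    then show ?thesis
      unfolding v[OF i] linear_diff[OF bounded_linear.linear[OF L(1)[OF i]]]
      by (simp add: algebra_simps)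
  qed
  then have "fin_seq m (\<lambda>i. v i (Suc n))
      = fin_seq m (\<lambda>i. v i n) - lam n *\<^sub>R (fin_seq m c + fin_seq m (\<lambda>i. - L i (y (int n))))"
    unfolding fin_seq_add fin_seq_scaleR fin_seq_diff by (intro fin_seq_cong) simp
  moreover have "(\<Sum>i=1..m. adjoint (L i) (coord (fin_seq m b) i)) = (\<Sum>i=1..m. adjoint (L i) (b i))" for b
    by (intro sum.cong) auto
  ultimately have "X (Suc n) = X n - lam n *\<^sub>R ((\<alpha>, fin_seq m c) + Q (Y (Suc n)) + (\<beta> n *\<^sub>R B (y (int n)), 0))"
    by (simp add: X_def Y_Suc Q_def algebra_simps)
  with \<alpha>(1) c(1) show ?thesis
    by blast
qed

text \<open>The correction only swaps old forward values for new ones, so it is a difference of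
  \<open>Q\<close> and \<open>B\<close> values at consecutive points; the weighted Lipschitz
  constants add up to the expression in the limsup condition.\<close>

lemma correction_bound:
  assumes "n \<ge> N"
  shows "norm (X (Suc n) - Y (Suc n)) \<le> c0 * norm (Y (Suc n) - Y n)"
proof -
  have "X (Suc n) - Y (Suc n) = lam n *\<^sub>R (Q (Y n) - Q (Y (Suc n)))
      + (lam n * \<beta> n) *\<^sub>R (B (y (int n - 1)) - B (y (int n)), 0)"
  proof -
    have "fin_seq m (\<lambda>i. v i (Suc n)) - fin_seq m (\<lambda>i. q i (int n))
        = lam n *\<^sub>R fin_seq m (\<lambda>i. - L i (y (int n - 1) - y (int n)))"
      unfolding fin_seq_diff fin_seq_scaleR
      by (intro fin_seq_cong) (simp add: v linear_diff[OF bounded_linear.linear[OF L(1)]] algebra_simps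
          del: One_nat_def)
    then show ?thesis
      unfolding Y_Suc unfolding Y_def Q_diff by (simp add: X_def x algebra_simps)
  qed
  then have "norm (X (Suc n) - Y (Suc n))
      \<le> norm (lam n *\<^sub>R (Q (Y n) - Q (Y (Suc n))))
        + norm ((lam n * \<beta> n) *\<^sub>R (B (y (int n - 1)) - B (y (int n)), 0 :: 'g fin_seq))"
    using norm_triangle_ineq by metis
  also have "\<dots> = lam n * norm (Q (Y n) - Q (Y (Suc n)))
      + lam n * \<beta> n * norm (B (y (int n - 1)) - B (y (int n)))"
    using lam(1)[of n] \<beta>[of n] by (simp add: norm_Pair)
  also have "\<dots> \<le> lam n * ((\<nu> + sqrt (\<Sum>i=1..m. (onorm (L i))\<^sup>2)) * norm (Y n - Y (Suc n)))
      + lam n * \<beta> n * (inverse \<mu> * norm (Y n - Y (Suc n)))"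
  proof (intro add_mono mult_left_mono lipschitz_Q Y_in_K)
    have "norm (B (y (int n - 1)) - B (y (int n))) \<le> inverse \<mu> * norm (fst (Y n - Y (Suc n)))"
      using lipschitz_onD[OF B(2), of "y (int n - 1)" "y (int n)"]
      by (simp add: Y_Suc Y_def dist_norm)
    also have "\<dots> \<le> inverse \<mu> * norm (Y n - Y (Suc n))"
      using B(1) by (intro mult_left_mono) (metis norm_fst_le prod.collapse, simp)
    finally show "norm (B (y (int n - 1)) - B (y (int n))) \<le> inverse \<mu> * norm (Y n - Y (Suc n))" .
  qed (use lam(1)[of n] \<beta>[of n] in auto)
  also have "\<dots> = (lam n * \<beta> n / \<mu> + lam n * (\<nu> + sqrt (\<Sum>i=1..m. (onorm (L i))\<^sup>2)))
      * norm (Y (Suc n) - Y n)"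
    by (simp add: norm_minus_commute divide_inverse algebra_simps)
  also have "\<dots> \<le> c0 * norm (Y (Suc n) - Y n)"
    using c0(2)[OF assms] by (intro mult_right_mono) auto
  finally show ?thesis .
qed

lemma c0_nonneg: "0 \<le> c0"
proof -
  have "0 \<le> lam N * \<beta> N / \<mu> + lam N * (\<nu> + sqrt (\<Sum>i=1..m. (onorm (L i))\<^sup>2))"
    using lam(1)[of N] \<beta>[of N] B(1) lipschitz_on_nonneg[OF D(2)]
    by (intro add_nonneg_nonneg mult_nonneg_nonneg divide_nonneg_nonneg) (auto simp: sum_nonneg)
  with c0(2)[of N] show ?thesis
    by simp
qed

lemma c0_gap: "0 < 1/2 - 2 * c0\<^sup>2"
  using power_strict_mono[OF c0(1) c0_nonneg, of 2] by (simp add: power2_eq_square)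

text \<open>The step direction minus \<open>e\<close> splits into a monotone difference from
  \<open>A\<close> and the \<open>Bs\<close>, a monotone difference of \<open>Q\<close>, and the
  penalization mismatch bounded by \<open>h\<close>. The parameter \<open>\<gamma>\<close> serves
  both conclusions: 0 for the averages, positive under strong monotonicity.\<close>

lemma descent_step:
  assumes n: "n \<ge> N"
    and A': "\<alpha> \<in> A w" and p: "p \<in> normal_cone C w" and b: "\<And>i. i \<in> {1..m} \<Longrightarrow> b i \<in> Bs i (c i)"
    and strong_A: "\<And>w a w' a'. a \<in> A w \<Longrightarrow> a' \<in> A w' \<Longrightarrow> \<gamma> * (norm (w - w'))\<^sup>2 \<le> (w - w') \<bullet> (a - a')"
    and strong_Bs: "\<And>i b c b' c'. i \<in> {1..m} \<Longrightarrow> b \<in> Bs i c \<Longrightarrow> b' \<in> Bs i c' \<Longrightarrow>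
      \<gamma> * (norm (b - b'))\<^sup>2 \<le> (b - b') \<bullet> (c - c')"
    and h: "\<And>n y. lam n * (\<beta> n * (B y \<bullet> (w - y)) + p \<bullet> (y - w)) \<le> h n"
    and u: "u = (w, fin_seq m b)" and e: "e = (\<alpha> + p, fin_seq m c) + Q u"
  shows "(norm (X (Suc n) - u))\<^sup>2 + (norm (X (Suc n) - Y (Suc n)))\<^sup>2
    \<le> (norm (X n - u))\<^sup>2 + (norm (X n - Y n))\<^sup>2 + 2 * lam n * (e \<bullet> (u - Y (Suc n)))
      - 2 * lam n * (\<gamma> * (norm (Y (Suc n) - u))\<^sup>2) + 2 * h n
      - (1/2 - 2 * c0\<^sup>2) * (norm (Y (Suc n) - Y n))\<^sup>2"
proof -
  obtain \<alpha>' c' where \<alpha>': "\<alpha>' \<in> A (y (int n))" and c': "\<forall>i\<in>{1..m}. q i (int n) \<in> Bs i (c' i)"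
    and X': "X (Suc n) = X n - lam n *\<^sub>R ((\<alpha>', fin_seq m c') + Q (Y (Suc n)) + (\<beta> n *\<^sub>R B (y (int n)), 0))"
    using product_step by blast
  define g where "g = (\<alpha>', fin_seq m c') + Q (Y (Suc n)) + (\<beta> n *\<^sub>R B (y (int n)), 0)"
  have uK: "u \<in> K"
    using Bs_carrier(1)[OF _ b] unfolding u K_def
    by (simp add: fin_seq_in_direct_sum_iff del: One_nat_def)
  have "\<gamma> * (norm (Y (Suc n) - u))\<^sup>2 \<le> ((\<alpha>', fin_seq m c') - (\<alpha>, fin_seq m c)) \<bullet> (Y (Suc n) - u)"
  proof -
    have "\<gamma> * (norm (Y (Suc n) - u))\<^sup>2
        = \<gamma> * (norm (y (int n) - w))\<^sup>2 + (\<Sum>i=1..m. \<gamma> * (norm (q i (int n) - b i))\<^sup>2)"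
      by (simp add: Y_Suc u norm_Pair fin_seq_diff norm_fin_seq sum_nonneg distrib_left sum_distrib_left)
    also have "\<dots> \<le> (y (int n) - w) \<bullet> (\<alpha>' - \<alpha>) + (\<Sum>i=1..m. (q i (int n) - b i) \<bullet> (c' i - c i))"
      using \<alpha>' A' c' b by (intro add_mono sum_mono strong_A strong_Bs) auto
    also have "\<dots> = ((\<alpha>', fin_seq m c') - (\<alpha>, fin_seq m c)) \<bullet> (Y (Suc n) - u)"
      by (simp add: Y_Suc u fin_seq_diff inner_fin_seq inner_commute)
    finally show ?thesis .
  qed
  moreover have "0 \<le> (Q (Y (Suc n)) - Q u) \<bullet> (Y (Suc n) - u)"
    using Y_in_K uK by (rule monotone_Q)
  moreover have "g - e = ((\<alpha>', fin_seq m c') - (\<alpha>, fin_seq m c)) + (Q (Y (Suc n)) - Q u)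
      + (\<beta> n *\<^sub>R B (y (int n)) - p, 0)"
    by (cases "Q (Y (Suc n))"; cases "Q u") (simp add: g_def e algebra_simps)
  moreover have "(\<beta> n *\<^sub>R B (y (int n)) - p, 0 :: 'g fin_seq) \<bullet> (Y (Suc n) - u)
      = - (\<beta> n * (B (y (int n)) \<bullet> (w - y (int n))) + p \<bullet> (y (int n) - w))"
    by (simp add: Y_Suc u inner_diff_left inner_diff_right algebra_simps)
  ultimately have "\<gamma> * (norm (Y (Suc n) - u))\<^sup>2
      - (\<beta> n * (B (y (int n)) \<bullet> (w - y (int n))) + p \<bullet> (y (int n) - w)) \<le> (g - e) \<bullet> (Y (Suc n) - u)"
    by (simp add: inner_add_left)
  from mult_left_mono[OF this less_imp_le[OF lam(1)[of n]]]
  have "lam n * (\<gamma> * (norm (Y (Suc n) - u))\<^sup>2) - h n \<le> lam n * ((g - e) \<bullet> (Y (Suc n) - u))"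
    using h[of n "y (int n)"] by (simp add: right_diff_distrib)
  also have "\<dots> = lam n * (g \<bullet> (Y (Suc n) - u)) + lam n * (e \<bullet> (u - Y (Suc n)))"
    by (simp add: inner_diff_left inner_diff_right algebra_simps)
  finally show ?thesis
    using forward_backward_descent[OF X'[folded g_def] correction_bound[OF n] c0_nonneg, of u]
    by (simp add: mult.assoc)
qed

lemma monotone_bounds:
  "a \<in> A w \<Longrightarrow> a' \<in> A w' \<Longrightarrow> 0 * (norm (w - w'))\<^sup>2 \<le> (w - w') \<bullet> (a - a')"
  "i \<in> {1..m} \<Longrightarrow> b \<in> Bs i c \<Longrightarrow> b' \<in> Bs i c' \<Longrightarrow> 0 * (norm (b - b'))\<^sup>2 \<le> (b - b') \<bullet> (c - c')"
  using A Bs[of i] monotone_opD[of A a w a' w'] monotone_opD[of "Bs i" b c b' c']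
  by (auto simp: maximally_monotone_on_def inner_commute)

section \<open>Zeros in the product and points of \<open>Z\<close>\<close>

lemma zero_fst:
  assumes "(u, 0) \<in> S"
  shows "fst u \<in> Z"
    "\<exists>\<alpha> p b c. \<alpha> \<in> A (fst u) \<and> p \<in> normal_cone C (fst u) \<and> (\<forall>i\<in>{1..m}. b i \<in> Bs i (c i)) \<and>
      u = (fst u, fin_seq m b) \<and> 0 = (\<alpha> + p, fin_seq m c) + Q u"
proof -
  obtain a where a: "a \<in> T u" "a + Q u = 0"
    using assms by (auto simp: S_def)
  obtain w b s c where 1: "u = (w, fin_seq m b)" "a = (s, fin_seq m c)"
    "s \<in> A w + normal_cone C w" "\<And>i. i \<in> {1..m} \<Longrightarrow> b i \<in> Bs i (c i)"
    using T_cases[OF a(1)] by blast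
  obtain \<alpha> p where \<alpha>: "s = \<alpha> + p" "\<alpha> \<in> A w" "p \<in> normal_cone C w"
    using 1(3) by (auto simp: set_plus_def)
  show "\<exists>\<alpha> p b c. \<alpha> \<in> A (fst u) \<and> p \<in> normal_cone C (fst u) \<and> (\<forall>i\<in>{1..m}. b i \<in> Bs i (c i)) \<and>
      u = (fst u, fin_seq m b) \<and> 0 = (\<alpha> + p, fin_seq m c) + Q u"
    using 1 \<alpha> a(2) by (intro exI[of _ \<alpha>] exI[of _ p] exI[of _ b] exI[of _ c]) simp
  have "(\<Sum>i=1..m. adjoint (L i) (coord (fin_seq m b) i)) = (\<Sum>i=1..m. adjoint (L i) (b i))"
    by (intro sum.cong) auto
  then have eq: "0 = s + (D w + (\<Sum>i=1..m. adjoint (L i) (b i)))"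
    "0 = fin_seq m (\<lambda>i. c i - L i w)"
    using a(2) unfolding 1 Q_def by (simp_all add: fin_seq_add zero_prod_def)
  \<comment> \<open>The dual component of the inclusion turns \<open>b i \<in> Bs i (c i)\<close>
    into \<open>b i \<in> Bs i (L i w)\<close>, as the composite operator requires.\<close>
  have "c i = L i w" if "i \<in> {1..m}" for i
    using arg_cong[OF eq(2), of "\<lambda>h. coord h i"] that by simp
  then have "(\<Sum>i=1..m. adjoint (L i) (b i)) \<in> (\<Sum>i=1..m. adjoint (L i) ` Bs i (L i w))"
    using 1(4) by (subst set_sum_alt) (auto simp del: One_nat_def)
  then have "\<alpha> + (\<Sum>i=1..m. adjoint (L i) (b i)) + D w + p
      \<in> A w + (\<Sum>i=1..m. adjoint (L i) ` Bs i (L i w)) + {D w} + normal_cone C w"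
    using \<alpha> by (intro set_plus_intro) auto
  moreover have "\<alpha> + (\<Sum>i=1..m. adjoint (L i) (b i)) + D w + p = 0"
    using eq(1) by (simp add: \<alpha>(1) algebra_simps)
  ultimately show "fst u \<in> Z"
    by (simp add: Z zer_def 1(1))
qed

text \<open>The elements of \<open>Bs i (L i w)\<close> occurring in the inclusion form the dual
  solution that completes \<open>w\<close>.\<close>

lemma zero_of_Z:
  assumes "w \<in> Z"
  shows "\<exists>b. ((w, b), 0) \<in> S"
proof -
  have "0 \<in> A w + (\<Sum>i=1..m. adjoint (L i) ` Bs i (L i w)) + {D w} + normal_cone C w"
    using assms by (simp add: Z zer_def)
  then obtain \<alpha> s p where 1: "0 = \<alpha> + s + D w + p" "\<alpha> \<in> A w" "p \<in> normal_cone C w"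
    "s \<in> (\<Sum>i=1..m. adjoint (L i) ` Bs i (L i w))"
    by (auto simp: set_plus_def)
  then obtain f where f: "s = (\<Sum>i=1..m. f i)" "\<forall>i\<in>{1..m}. f i \<in> adjoint (L i) ` Bs i (L i w)"
    by (auto simp: set_sum_alt simp del: One_nat_def)
  from f(2) obtain b where b: "\<And>i. i \<in> {1..m} \<Longrightarrow> b i \<in> Bs i (L i w)"
    "\<And>i. i \<in> {1..m} \<Longrightarrow> f i = adjoint (L i) (b i)"
    unfolding image_iff by metis
  have "(\<Sum>i=1..m. adjoint (L i) (coord (fin_seq m b) i)) = s"
    unfolding f(1) using b(2) by (intro sum.cong) auto
  then have "(\<alpha> + p, fin_seq m (\<lambda>i. L i w)) + Q (w, fin_seq m b) = (\<alpha> + s + D w + p, 0)"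
    by (auto simp: Q_def fin_seq_add algebra_simps intro!: fin_seq_eqI)
  then have "(\<alpha> + p, fin_seq m (\<lambda>i. L i w)) + Q (w, fin_seq m b) = 0"
    using 1(1) by (simp add: zero_prod_def)
  moreover have "(\<alpha> + p, fin_seq m (\<lambda>i. L i w)) \<in> T (w, fin_seq m b)"
    using 1 b(1) by (auto simp: T_iff intro: set_plus_intro)
  ultimately show ?thesis
    unfolding S_def by (smt (verit, ccfv_SIG) mem_Collect_eq)
qed

sublocale ergodic_scheme K S X Y lam "1/2 - 2 * c0\<^sup>2" N
proof
  show "subspace K" "complete K"
    by (fact K)+
  show "S \<subseteq> K \<times> K"
  proof -
    have "u \<in> K \<and> a + Q u \<in> K" if "a \<in> T u" for u a
    proof -
      have "u \<in> K" "a \<in> K"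
        using T_in_K that unfolding Gr_def by blast+
      then show ?thesis
        using subspace_add[OF K(1) _ Q_in_K] by blast
    qed
    then show ?thesis
      unfolding S_def by blast
  qed
  show "norm (X (Suc n) - Y (Suc n)) \<le> norm (Y (Suc n) - Y n)" if "n \<ge> N" for n
    using correction_bound[OF that] mult_right_mono[of c0 1 "norm (Y (Suc n) - Y n)"] c0(1)
    by simp
  show "\<exists>h. summable h \<and> (\<forall>n\<ge>N.
      (norm (X (Suc n) - u))\<^sup>2 + (norm (X (Suc n) - Y (Suc n)))\<^sup>2
        \<le> (norm (X n - u))\<^sup>2 + (norm (X n - Y n))\<^sup>2 + 2 * lam n * (e \<bullet> (u - Y (Suc n)))
          + h n - (1/2 - 2 * c0\<^sup>2) * (norm (Y (Suc n) - Y n))\<^sup>2)" if ue: "(u, e) \<in> S" for u e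
  proof -
    obtain a where a: "a \<in> T u" "e = a + Q u"
      using ue unfolding S_def by blast
    obtain w b s c where 1: "u = (w, fin_seq m b)" "a = (s, fin_seq m c)"
      "s \<in> A w + normal_cone C w" "\<And>i. i \<in> {1..m} \<Longrightarrow> b i \<in> Bs i (c i)"
      using T_cases[OF a(1)] by blast
    obtain \<alpha> p where \<alpha>: "s = \<alpha> + p" "\<alpha> \<in> A w" "p \<in> normal_cone C w"
      using 1(3) by (auto simp: set_plus_def)
    obtain h where h: "summable h" "\<And>n y. lam n * (\<beta> n * (B y \<bullet> (w - y)) + p \<bullet> (y - w)) \<le> h n"
      using gap[OF \<alpha>(3)] by blast
    have e: "e = (\<alpha> + p, fin_seq m c) + Q u"
      by (simp add: a(2) 1(2) \<alpha>(1))
    have "(norm (X (Suc n) - u))\<^sup>2 + (norm (X (Suc n) - Y (Suc n)))\<^sup>2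
      \<le> (norm (X n - u))\<^sup>2 + (norm (X n - Y n))\<^sup>2 + 2 * lam n * (e \<bullet> (u - Y (Suc n)))
        - 2 * lam n * (0 * (norm (Y (Suc n) - u))\<^sup>2) + 2 * h n
        - (1/2 - 2 * c0\<^sup>2) * (norm (Y (Suc n) - Y n))\<^sup>2" if "n \<ge> N" for n
      by (rule descent_step[OF that \<alpha>(2,3) 1(4)[rule_format] _ _ h(2) 1(1) e])
        (use monotone_bounds in blast)+
    then show ?thesis
      by (intro exI[of _ "\<lambda>n. 2 * h n"]) (simp add: summable_mult h(1))
  qed
  show "\<exists>u. (u, 0) \<in> S"
    using zero_of_Z Z_nonempty by blast
  show "(l, 0) \<in> S" if l: "l \<in> K" "\<And>u w. (u, w) \<in> S \<Longrightarrow> 0 \<le> w \<bullet> (u - l)" for l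
  proof -
    \<comment> \<open>The perturbation lemma takes the place of a sum theorem for maximally monotone
      operators.\<close>
    have "- Q l \<in> T l"
    proof (rule zero_of_lipschitz_perturbation[OF K monotone_T T_in_K T_range Q_in_K lipschitz_Q l(1)])
      fix u a assume "a \<in> T u"
      then have "(u, a + Q u) \<in> S"
        unfolding S_def by blast
      then show "0 \<le> (a + Q u) \<bullet> (u - l)"
        by (rule l(2))
    qed
    moreover have "(l, 0) = (l, - Q l + Q l)"
      by simp
    ultimately show ?thesis
      unfolding S_def by blast
  qed
qed (use lam c0_gap in auto)

section \<open>Convergence of the averages and of the iterates\<close>

theorem averages_weakly_convergent:
  "\<exists>w\<in>Z. weakly_tendsto (\<lambda>n. (1 / (\<Sum>k=0..n. lam k)) *\<^sub>R (\<Sum>k=0..n. lam k *\<^sub>R x k)) w"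
proof -
  obtain l where l: "(l, 0) \<in> S" "\<And>w. w \<in> K \<Longrightarrow> (\<lambda>n. avg n \<bullet> w) \<longlonglongrightarrow> l \<bullet> w"
    using avg_weakly_convergent by blast
  have "(\<lambda>n. (1 / (\<Sum>k=0..n. lam k)) *\<^sub>R (\<Sum>k=0..n. lam k *\<^sub>R x k) \<bullet> w) \<longlonglongrightarrow> fst l \<bullet> w" for w
  proof -
    \<comment> \<open>Test vectors \<open>(w, 0)\<close> isolate the first component of the
      averages.\<close>
    have "(w, 0) \<in> K"
      using subspace_0[OF subspace_direct_sum[OF G(1)]] by (auto simp: K_def simp del: One_nat_def)
    from l(2)[OF this, unfolded avg_inner] show ?thesis
      by (simp add: X_def inner_prod_def inner_sum_left atLeast0AtMost)
  qed
  with zero_fst(1)[OF l(1)] show ?thesis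
    unfolding weakly_tendsto_def by blast
qed

text \<open>Every point of \<open>Z\<close> turns out to be the limit of \<open>x\<close>, so
  uniqueness of limits also makes \<open>Z\<close> a singleton.\<close>

theorem iterates_strongly_convergent:
  assumes \<gamma>: "0 < \<gamma>"
    and strong_A: "\<And>w a w' a'. a \<in> A w \<Longrightarrow> a' \<in> A w' \<Longrightarrow> \<gamma> * (norm (w - w'))\<^sup>2 \<le> (w - w') \<bullet> (a - a')"
    and strong_Bs: "\<And>i b c b' c'. i \<in> {1..m} \<Longrightarrow> b \<in> Bs i c \<Longrightarrow> b' \<in> Bs i c' \<Longrightarrow>
      \<gamma> * (norm (b - b'))\<^sup>2 \<le> (b - b') \<bullet> (c - c')"
  shows "\<exists>w. Z = {w} \<and> x \<longlonglongrightarrow> w"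
proof -
  have lim: "x \<longlonglongrightarrow> w" if "w \<in> Z" for w
  proof -
    obtain b' where zero: "((w, b'), 0) \<in> S"
      using zero_of_Z \<open>w \<in> Z\<close> by blast
    define u where "u = (w, b')"
    obtain \<alpha> p b c where 1: "\<alpha> \<in> A w" "p \<in> normal_cone C w" "\<And>i. i \<in> {1..m} \<Longrightarrow> b i \<in> Bs i (c i)"
      "u = (w, fin_seq m b)" "0 = (\<alpha> + p, fin_seq m c) + Q u"
      using zero_fst(2)[OF zero] unfolding u_def fst_conv by blast
    obtain h where h: "summable h" "\<And>n y. lam n * (\<beta> n * (B y \<bullet> (w - y)) + p \<bullet> (y - w)) \<le> h n"
      using gap[OF 1(2)] by blast
    have "X \<longlonglongrightarrow> u"
    proof (rule strongly_convergent[OF _ \<gamma>])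
      show "summable (\<lambda>n. 2 * h n)"
        using h(1) by (rule summable_mult)
      show "(norm (X (Suc n) - u))\<^sup>2 + (norm (X (Suc n) - Y (Suc n)))\<^sup>2
        \<le> (norm (X n - u))\<^sup>2 + (norm (X n - Y n))\<^sup>2
          - 2 * lam n * (\<gamma> * (norm (Y (Suc n) - u))\<^sup>2) + 2 * h n" if "n \<ge> N" for n
      proof -
        have "0 \<le> (1/2 - 2 * c0\<^sup>2) * (norm (Y (Suc n) - Y n))\<^sup>2"
          using c0_gap by simp
        moreover have "(norm (X (Suc n) - u))\<^sup>2 + (norm (X (Suc n) - Y (Suc n)))\<^sup>2
          \<le> (norm (X n - u))\<^sup>2 + (norm (X n - Y n))\<^sup>2 + 2 * lam n * (0 \<bullet> (u - Y (Suc n)))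
            - 2 * lam n * (\<gamma> * (norm (Y (Suc n) - u))\<^sup>2) + 2 * h n
            - (1/2 - 2 * c0\<^sup>2) * (norm (Y (Suc n) - Y n))\<^sup>2"
          by (rule descent_step[OF that 1(1-3) _ _ h(2) 1(4,5)]) (use strong_A strong_Bs in blast)+
        ultimately show ?thesis
          by simp
      qed
    qed (use zero u_def in auto)
    from tendsto_fst[OF this] show ?thesis
      by (simp add: X_def u_def)
  qed
  obtain w where "w \<in> Z"
    using Z_nonempty by blast
  with lim have "Z = {w}"
    using LIMSEQ_unique by blast
  with lim show ?thesis
    by blast
qed

end

(* The Hilbert spaces G_1, ..., G_m are complete subspaces of a common inner product space 'g;
   their Hilbert direct sum shows that every finite family has this form. The adjoint of L_i is
   the restriction to G_i of the adjoint of L_i viewed as a map into 'g.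
   The sequences y and q_i start at index -1 and are therefore indexed by int. *)
theorem theorem9:
  fixes A :: "'h::{real_inner, complete_space} \<Rightarrow> 'h set"
    and D B :: "'h \<Rightarrow> 'h"
    and m :: nat
    and G :: "nat \<Rightarrow> 'g::real_inner set"
    and Bs :: "nat \<Rightarrow> 'g \<Rightarrow> 'g set"
    and L :: "nat \<Rightarrow> 'h \<Rightarrow> 'g"
    and \<nu> \<mu> :: real
    and C Z :: "'h set"
    and lam \<beta> \<tau> :: "nat \<Rightarrow> real"
    and x z :: "nat \<Rightarrow> 'h"
    and y :: "int \<Rightarrow> 'h"
    and v :: "nat \<Rightarrow> nat \<Rightarrow> 'g"
    and q :: "nat \<Rightarrow> int \<Rightarrow> 'g"
  assumes A: "maximally_monotone A"
    and D: "monotone_op (\<lambda>w. {D w})" "\<nu> > 0" "\<nu>-lipschitz_on UNIV D"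
    and m: "m \<ge> 1"
    and G: "\<And>i. i \<in> {1..m} \<Longrightarrow> subspace (G i) \<and> complete (G i)"
    and Bs: "\<And>i. i \<in> {1..m} \<Longrightarrow> maximally_monotone_on (G i) (Bs i)"
    and L: "\<And>i. i \<in> {1..m} \<Longrightarrow> bounded_linear (L i) \<and> range (L i) \<subseteq> G i \<and> L i \<noteq> (\<lambda>w. 0)"
    and B: "monotone_op (\<lambda>w. {B w})" "\<mu> > 0" "(inverse \<mu>)-lipschitz_on UNIV B"
    and C: "C = zer (\<lambda>w. {B w})" "C \<noteq> {}"
    and Z: "Z = zer (\<lambda>w. A w + (\<Sum>i=1..m. adjoint (L i) ` Bs i (L i w)) + {D w} + normal_cone C w)"
    and pos: "\<And>n. lam n > 0" "\<And>n. \<beta> n > 0"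
    and init: "\<And>i. i \<in> {1..m} \<Longrightarrow> v i 0 \<in> G i"
      "y (-1) = x 0"
      "\<And>i. i \<in> {1..m} \<Longrightarrow> q i (-1) = v i 0"
    and y: "\<And>n. y (int n) = resolvent (scale_op (lam n) A)
        (x n - lam n *\<^sub>R (D (y (int n - 1)) + (\<Sum>i=1..m. adjoint (L i) (q i (int n - 1))))
             - (lam n * \<beta> n) *\<^sub>R B (y (int n - 1)))"
    and q: "\<And>i n. i \<in> {1..m} \<Longrightarrow>
        q i (int n) = resolvent (scale_op (lam n) (inv_op (Bs i)))
          (v i n + lam n *\<^sub>R L i (y (int n - 1)))"
    and x: "\<And>n. x (Suc n) =
        (lam n * \<beta> n) *\<^sub>R (B (y (int n - 1)) - B (y (int n)))
        + lam n *\<^sub>R (D (y (int n - 1)) - D (y (int n)))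
        + lam n *\<^sub>R (\<Sum>i=1..m. adjoint (L i) (q i (int n - 1) - q i (int n)))
        + y (int n)"
    and v: "\<And>i n. i \<in> {1..m} \<Longrightarrow>
        v i (Suc n) = lam n *\<^sub>R L i (y (int n) - y (int n - 1)) + q i (int n)"
    and tau: "\<And>n. \<tau> n = (\<Sum>k=0..n. lam k)"
    and z: "\<And>n. z n = (1 / \<tau> n) *\<^sub>R (\<Sum>k=0..n. lam k *\<^sub>R x k)"
    and i: "maximally_monotone (\<lambda>w. A w + normal_cone C w)" "Z \<noteq> {}"
    and ii: "\<And>p. p \<in> ran_op (normal_cone C) \<Longrightarrow>
        (\<Sum>n. ereal (lam n * \<beta> n) *
          ((SUP u\<in>C. fitzpatrick (\<lambda>w. {B w}) u (p /\<^sub>R \<beta> n)) - support_fun C (p /\<^sub>R \<beta> n))) < \<infinity>"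
    and iii: "summable (\<lambda>n. (lam n)\<^sup>2)" "\<not> summable lam"
    and limsup: "limsup (\<lambda>n. ereal (lam n * \<beta> n / \<mu>
        + lam n * (\<nu> + sqrt (\<Sum>i=1..m. (onorm (L i))\<^sup>2)))) < ereal (1/2)"
  shows "(\<exists>w\<in>Z. weakly_tendsto z w) \<and>
    (strongly_monotone_op A \<and> (\<forall>i\<in>{1..m}. strongly_monotone_op (inv_op (Bs i))) \<longrightarrow>
      (\<exists>w. Z = {w} \<and> x \<longlonglongrightarrow> w))"
proof -
  have LL: "bounded_linear (L i)" "L i w \<in> G i" if "i \<in> {1..m}" for i w
    using L[OF that] by auto
  obtain c0 where c0: "limsup (\<lambda>n. ereal (lam n * \<beta> n / \<mu>
      + lam n * (\<nu> + sqrt (\<Sum>i=1..m. (onorm (L i))\<^sup>2)))) < ereal c0" "c0 < 1 / 2"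
    using ereal_dense2[OF limsup] by auto
  obtain N where N: "\<And>n. n \<ge> N \<Longrightarrow> lam n * \<beta> n / \<mu>
      + lam n * (\<nu> + sqrt (\<Sum>i=1..m. (onorm (L i))\<^sup>2)) \<le> c0"
    using Limsup_lessD[OF c0(1)] unfolding eventually_sequentially by (auto intro: less_imp_le)
  interpret primal_dual A D B m G Bs L \<nu> \<mu> C Z lam \<beta> x y v q c0 N
  proof (rule primal_dual.intro)
    fix u p assume p: "p \<in> normal_cone C u"
    then have "p \<in> ran_op (normal_cone C)"
      by (auto simp: ran_op_def)
    from fitzpatrick_gap_summable[OF C(1) p pos ii[OF this]]
    show "\<exists>h. summable h \<and> (\<forall>n y. lam n * (\<beta> n * (B y \<bullet> (u - y)) + p \<bullet> (y - u)) \<le> h n)" .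
  qed (fact A D B LL Bs G[THEN conjunct1] G[THEN conjunct2] Z i iii(2) pos init y q x v c0(2) N)+
  have "z = (\<lambda>n. (1 / (\<Sum>k=0..n. lam k)) *\<^sub>R (\<Sum>k=0..n. lam k *\<^sub>R x k))"
    by (rule ext) (simp add: z tau)
  with averages_weakly_convergent have "\<exists>w\<in>Z. weakly_tendsto z w"
    by simp
  moreover have "\<exists>w. Z = {w} \<and> x \<longlonglongrightarrow> w"
    if strong: "strongly_monotone_op A" "\<forall>i\<in>{1..m}. strongly_monotone_op (inv_op (Bs i))"
  proof -
    obtain a where a: "a > 0" "\<And>w s w' s'. s \<in> A w \<Longrightarrow> s' \<in> A w' \<Longrightarrow>
        a * (norm (w - w'))\<^sup>2 \<le> (w - w') \<bullet> (s - s')"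
      using strong(1) unfolding strongly_monotone_op_def Gr_def by blast
    have "\<forall>i\<in>{1..m}. \<exists>g>0. \<forall>b c b' c'. b \<in> Bs i c \<longrightarrow> b' \<in> Bs i c' \<longrightarrow>
        g * (norm (b - b'))\<^sup>2 \<le> (b - b') \<bullet> (c - c')"
      using strong(2) unfolding strongly_monotone_op_def Gr_def inv_op_def by blast
    then obtain g where g: "\<And>i. i \<in> {1..m} \<Longrightarrow> g i > 0"
      "\<And>i b c b' c'. i \<in> {1..m} \<Longrightarrow> b \<in> Bs i c \<Longrightarrow> b' \<in> Bs i c' \<Longrightarrow>
        g i * (norm (b - b'))\<^sup>2 \<le> (b - b') \<bullet> (c - c')"
      by metis
    \<comment> \<open>Strong monotonicity comes with one constant per operator, but the estimate in
      the product needs a common one.\<close>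
    define \<gamma> where "\<gamma> = Min (insert a (g ` {1..m}))"
    have "\<gamma> > 0"
      using a(1) g(1) unfolding \<gamma>_def by (subst Min_gr_iff) auto
    moreover have "\<gamma> \<le> a"
      unfolding \<gamma>_def by (intro Min_le) auto
    then have "\<gamma> * (norm (w - w'))\<^sup>2 \<le> (w - w') \<bullet> (s - s')" if "s \<in> A w" "s' \<in> A w'" for w s w' s'
      using a(2)[OF that] mult_right_mono[of \<gamma> a "(norm (w - w'))\<^sup>2"] by simp
    moreover have "\<gamma> * (norm (b - b'))\<^sup>2 \<le> (b - b') \<bullet> (c - c')"
      if "i \<in> {1..m}" "b \<in> Bs i c" "b' \<in> Bs i c'" for i b c b' c'
    proof -
      have "\<gamma> \<le> g i"
        unfolding \<gamma>_def using that(1) by (intro Min_le) auto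
      then show ?thesis
        using g(2)[OF that] mult_right_mono[of \<gamma> "g i" "(norm (b - b'))\<^sup>2"] by simp
    qed
    ultimately show ?thesis
      by (rule iterates_strongly_convergent)
  qed
  ultimately show ?thesis
    by blast
qed

end
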